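(* Let $\mathbf{k}/\mathbf{k}_0$ be a quadratic extension of finite fields of odd characteristic $p$, let $n\ge2$, let $R$ be a field of characteristic different from $p$ (containing the $p$-th roots of unity), let $\pi$ be an absolutely irreducible cuspidal $R$-representation of $\mathrm{GL}_n(\mathbf{k})$ distinguished by $\mathrm{GL}_n(\mathbf{k}_0)$, and let $\psi_0:\mathbf{k}_0\to R^\times$ be a non-trivial character. Suppose that $|M_n(\mathbf{k})|^{1/2}=|M_n(\mathbf{k}_0)|$ in $R$. Then $$\gamma(\pi,\psi_0\circ\mathrm{tr}_{\mathbf{k}/\mathbf{k}_0})=\omega_\pi(\delta),$$ where $\omega_\pi$ is the central character of $\pi$ and $\delta\in\mathbf{k}^\times$ is an element with $\mathrm{tr}_{\mathbf{k}/\mathbf{k}_0}(\delta)=0$.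
   Context: An $R$-representation $(\pi,V)$ of $G=\mathrm{GL}_n(\mathbf{k})$ is cuspidal if the coinvariants $V_U$ vanish for the unipotent radical $U$ of every proper parabolic subgroup of $G$; it is distinguished by a subgroup $H$ if $\mathrm{Hom}_{R[H]}(\pi,R)\neq0$ (trivial action on $R$). With $V^\vee=\mathrm{Hom}_R(V,R)$ and $\pi^\vee$ the contragredient, for a non-trivial character $\psi:\mathbf{k}\to R^\times$ the gamma factor $\gamma(\pi,\psi)\in R$ is the scalar by which $|M_n(\mathbf{k})|^{-1/2}\sum_{g\in G}\psi(\mathrm{tr}(g))\pi^\vee(g)$ acts on $V^\vee$, where $|M_n(\mathbf{k})|^{1/2}$ is the chosen square root of $|M_n(\mathbf{k})|$ in $R$. Equivalently, it is the scalar such that $\sum_{g\in G}\widehat\Phi(g)v^\vee(\pi(g^{-1})v)=\gamma(\pi,\psi)\sum_{g\in G}\Phi(g)v^\vee(\pi(g)v)$ for all $v\in V$, $v^\vee\in V^\vee$ and all $\Phi:M_n(\mathbf{k})\to R$ supported on $G$, with $\widehat\Phi(a)=|M_n(\mathbf{k})|^{-1/2}\sum_{g\in M_n(\mathbf{k})}\Phi(g)\psi(\mathrm{tr}(ga))$. *)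

theory Defs
  imports
    "HOL-Algebra.Algebraic_Closure_Type"
    "HOL-Library.Poly_Mapping"
    "Jordan_Normal_Form.VS_Connect"
begin

section \<open>General linear groups\<close>

definition GL :: "nat \<Rightarrow> 'a::field mat monoid" where
  "GL n = units_of (ring_mat TYPE('a) n ())"

definition mat_tr :: "'a::comm_monoid_add mat \<Rightarrow> 'a" where
  "mat_tr A = (\<Sum>i<dim_row A. A $$ (i, i))"

text \<open>A flag is the list of its members, with both \<open>{0}\<close> and the whole space included.\<close>

definition is_flag :: "nat \<Rightarrow> 'a::field vec set list \<Rightarrow> bool" where
  "is_flag n F \<longleftrightarrow> F \<noteq> [] \<and>
     (\<forall>W\<in>set F. VectorSpace.subspace class_ring W (module_vec TYPE('a) n)) \<and>
     sorted_wrt (\<subset>) F \<and> hd F = {0\<^sub>v n} \<and> last F = carrier_vec n"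

definition parabolic :: "nat \<Rightarrow> 'a::field vec set list \<Rightarrow> 'a mat set" where
  "parabolic n F = {g \<in> carrier (GL n). \<forall>W\<in>set F. \<forall>x\<in>W. g *\<^sub>v x \<in> W}"

text \<open>The unipotent radical of the stabilizer of a flag consists of the elements acting trivially
  on each successive quotient of the flag.\<close>

definition unipotent_radical :: "nat \<Rightarrow> 'a::field vec set list \<Rightarrow> 'a mat set" where
  "unipotent_radical n F = {g \<in> carrier (GL n).
     \<forall>i. Suc i < length F \<longrightarrow> (\<forall>x\<in>F ! Suc i. g *\<^sub>v x - x \<in> F ! i)}"

section \<open>Traces of field extensions and additive characters\<close>

text \<open>An extension is given by an embedding \<open>\<iota>\<close> of the small field into the large one.\<close>

definition ext_scale :: "('a::field \<Rightarrow> 'b::field) \<Rightarrow> 'a \<Rightarrow> 'b \<Rightarrow> 'b" where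
  "ext_scale \<iota> a x = \<iota> a * x"

definition linear_trace :: "('a::field \<Rightarrow> 'b::ab_group_add \<Rightarrow> 'b) \<Rightarrow> ('b \<Rightarrow> 'b) \<Rightarrow> 'a" where
  "linear_trace scale T =
     (let B = (SOME B. \<not> Modules.module.dependent scale B \<and> Modules.module.span scale B = UNIV)
      in \<Sum>b\<in>B. Modules.module.representation scale B (T b) b)"

definition field_trace :: "('a::field \<Rightarrow> 'b::field) \<Rightarrow> 'b \<Rightarrow> 'a" where
  "field_trace \<iota> x = linear_trace (ext_scale \<iota>) ((*) x)"

definition additive_character :: "('a::ab_group_add \<Rightarrow> 'r::field) \<Rightarrow> bool" where
  "additive_character \<psi> \<longleftrightarrow> (\<forall>x. \<psi> x \<noteq> 0) \<and> (\<forall>x y. \<psi> (x + y) = \<psi> x * \<psi> y)"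

section \<open>Representations\<close>

locale group_representation = group G + vector_space scale
  for G :: "('g, 'm) monoid_scheme" (structure)
    and scale :: "'r::field \<Rightarrow> 'v::ab_group_add \<Rightarrow> 'v" +
  fixes \<pi> :: "'g \<Rightarrow> 'v \<Rightarrow> 'v"
  assumes linear: "g \<in> carrier G \<Longrightarrow> Vector_Spaces.linear scale scale (\<pi> g)"
    and one: "\<pi> \<one> v = v"
    and mult: "g \<in> carrier G \<Longrightarrow> h \<in> carrier G \<Longrightarrow> \<pi> (g \<otimes> h) v = \<pi> g (\<pi> h v)"

text \<open>Let \<open>E\<close> be the algebraic closure of the coefficient field \<open>R\<close>. The space obtained from \<open>V\<close>
  by extension of scalars is the quotient of the free \<open>E\<close>-vector space on the set \<open>V\<close> (finitely
  supported functions) by the subspace \<open>tensor_kernel\<close> spanned by the bilinearity relations.\<close>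

definition ac_smult :: "'e::field \<Rightarrow> ('v \<Rightarrow>\<^sub>0 'e) \<Rightarrow> ('v \<Rightarrow>\<^sub>0 'e)" where
  "ac_smult c x = Poly_Mapping.map ((*) c) x"

definition tensor_kernel ::
    "('r::field \<Rightarrow> 'v::ab_group_add \<Rightarrow> 'v) \<Rightarrow> ('v \<Rightarrow>\<^sub>0 'r alg_closure) set" where
  "tensor_kernel scale = Modules.module.span ac_smult
     ({Poly_Mapping.single (v + w) 1 - Poly_Mapping.single v 1 - Poly_Mapping.single w 1 |v w. True} \<union>
      {Poly_Mapping.single (scale a v) 1 - Poly_Mapping.single v (to_ac a) |a v. True})"

definition free_map :: "('v \<Rightarrow> 'w) \<Rightarrow> ('v \<Rightarrow>\<^sub>0 'e::comm_monoid_add) \<Rightarrow> ('w \<Rightarrow>\<^sub>0 'e)" where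
  "free_map f x =
     (\<Sum>v\<in>Poly_Mapping.keys x. Poly_Mapping.single (f v) (Poly_Mapping.lookup x v))"

text \<open>Irreducibility after extension of scalars to the algebraic closure: subrepresentations of the
  quotient are identified with the stable subspaces containing \<open>tensor_kernel\<close>.\<close>

definition absolutely_irreducible ::
    "('g, 'm) monoid_scheme \<Rightarrow> ('r::field \<Rightarrow> 'v::ab_group_add \<Rightarrow> 'v) \<Rightarrow> ('g \<Rightarrow> 'v \<Rightarrow> 'v) \<Rightarrow> bool" where
  "absolutely_irreducible G scale \<pi> \<longleftrightarrow>
     tensor_kernel scale \<noteq> UNIV \<and>
     (\<forall>W. Modules.module.subspace ac_smult W \<and> tensor_kernel scale \<subseteq> W \<and>
          (\<forall>g\<in>carrier G. \<forall>x\<in>W. free_map (\<pi> g) x \<in> W) \<longrightarrow>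
        W = tensor_kernel scale \<or> W = UNIV)"

text \<open>The subspace \<open>coinvariant_kernel\<close> is the one whose quotient is the space of coinvariants.\<close>

definition coinvariant_kernel ::
    "('r::field \<Rightarrow> 'v::ab_group_add \<Rightarrow> 'v) \<Rightarrow> ('g \<Rightarrow> 'v \<Rightarrow> 'v) \<Rightarrow> 'g set \<Rightarrow> 'v set" where
  "coinvariant_kernel scale \<pi> U = Modules.module.span scale {\<pi> u v - v |u v. u \<in> U}"

definition cuspidal ::
    "nat \<Rightarrow> ('r::field \<Rightarrow> 'v::ab_group_add \<Rightarrow> 'v) \<Rightarrow> ('k::field mat \<Rightarrow> 'v \<Rightarrow> 'v) \<Rightarrow> bool" where
  "cuspidal n scale \<pi> \<longleftrightarrow>
     (\<forall>F. is_flag n F \<and> parabolic n F \<noteq> carrier (GL n) \<longrightarrow>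
        coinvariant_kernel scale \<pi> (unipotent_radical n F) = UNIV)"

definition dual_space :: "('r::field \<Rightarrow> 'v::ab_group_add \<Rightarrow> 'v) \<Rightarrow> ('v \<Rightarrow> 'r) set" where
  "dual_space scale = {\<xi>. Vector_Spaces.linear scale (*) \<xi>}"

definition distinguished ::
    "('r::field \<Rightarrow> 'v::ab_group_add \<Rightarrow> 'v) \<Rightarrow> ('g \<Rightarrow> 'v \<Rightarrow> 'v) \<Rightarrow> 'g set \<Rightarrow> bool" where
  "distinguished scale \<pi> H \<longleftrightarrow>
     (\<exists>\<xi>\<in>dual_space scale. (\<exists>v. \<xi> v \<noteq> 0) \<and> (\<forall>h\<in>H. \<forall>v. \<xi> (\<pi> h v) = \<xi> v))"

definition contragredient ::
    "('g, 'm) monoid_scheme \<Rightarrow> ('g \<Rightarrow> 'v \<Rightarrow> 'v) \<Rightarrow> 'g \<Rightarrow> ('v \<Rightarrow> 'r) \<Rightarrow> 'v \<Rightarrow> 'r" where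
  "contragredient G \<pi> g \<xi> = (\<lambda>v. \<xi> (\<pi> (inv\<^bsub>G\<^esub> g) v))"

definition central_character ::
    "nat \<Rightarrow> ('r::field \<Rightarrow> 'v::ab_group_add \<Rightarrow> 'v) \<Rightarrow> ('k::field mat \<Rightarrow> 'v \<Rightarrow> 'v) \<Rightarrow> 'k \<Rightarrow> 'r" where
  "central_character n scale \<pi> z = (THE c. \<forall>v. \<pi> (z \<cdot>\<^sub>m 1\<^sub>m n) v = scale c v)"

text \<open>The argument \<open>s\<close> is the chosen square root in \<open>R\<close> of the cardinality of the ring of matrices.\<close>

definition gamma_factor ::
    "nat \<Rightarrow> ('r::field \<Rightarrow> 'v::ab_group_add \<Rightarrow> 'v) \<Rightarrow> ('k::field mat \<Rightarrow> 'v \<Rightarrow> 'v) \<Rightarrow>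
     'r \<Rightarrow> ('k \<Rightarrow> 'r) \<Rightarrow> 'r" where
  "gamma_factor n scale \<pi> s \<psi> =
     (THE c. \<forall>\<xi>\<in>dual_space scale. \<forall>v.
        inverse s * (\<Sum>g\<in>carrier (GL n). \<psi> (mat_tr g) * contragredient (GL n) \<pi> g \<xi> v) = c * \<xi> v)"

end

theory Submission
  imports Defs "HOL-Algebra.Sylow" "Jordan_Normal_Form.Matrix_Kernel"
begin

text \<open>By Schur's lemma the Gauss sum \<open>T = \<Sum>\<^sub>g \<psi>(tr g) \<pi>(g\<^sup>-\<^sup>1)\<close> is a scalar \<open>c\<close>, so it suffices to
  evaluate it against a nonzero form \<open>\<xi>\<close> invariant under \<open>H = GL\<^sub>n(k\<^sub>0)\<close>. Grouping the sum
  over the cosets \<open>Hx\<close> gives \<open>\<xi>(\<pi>(x) v)\<close> the weight \<open>\<Sum> \<psi>(tr(x\<^sup>-\<^sup>1 a))\<close> with \<open>a\<close> running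
  over \<open>H\<close>. The singular matrices \<open>a\<close> over \<open>k\<^sub>0\<close> may be added to this sum: by cuspidality they
  contribute nothing. The completed sum over all \<open>a \<in> M\<^sub>n(k\<^sub>0)\<close> is \<open>|M\<^sub>n(k\<^sub>0)|\<close> if the entrywise
  trace of \<open>x\<^sup>-\<^sup>1\<close> is zero, that is, if \<open>x\<^sup>-\<^sup>1 \<in> \<delta>H\<close>, and \<open>0\<close> otherwise. Hence
  \<open>\<xi>(T v) = |M\<^sub>n(k\<^sub>0)| \<xi>(\<pi>(\<delta>\<^sup>-\<^sup>1) v)\<close>, and \<open>\<omega>(\<delta>)\<^sup>2 = 1\<close> since \<open>\<delta>\<^sup>2 \<in> k\<^sub>0\<close>. One must sum over
  cosets of \<open>H\<close> and not average over \<open>H\<close>: the order of \<open>H\<close> may vanish in the coefficient field.\<close>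

section \<open>Extension of scalars\<close>

lemma lookup_ac_smult: "Poly_Mapping.lookup (ac_smult c x) v = c * Poly_Mapping.lookup x v"
  by (simp add: ac_smult_def Poly_Mapping.map.rep_eq when_def)

interpretation ac: vector_space "ac_smult :: 'e::field \<Rightarrow> ('v \<Rightarrow>\<^sub>0 'e) \<Rightarrow> _"
  by unfold_locales
    (auto intro!: poly_mapping_eqI simp: lookup_ac_smult lookup_add algebra_simps)

lemma ac_smult_single: "ac_smult c (Poly_Mapping.single v d) = Poly_Mapping.single v (c * d)"
  by (intro poly_mapping_eqI) (simp add: lookup_ac_smult lookup_single when_def)

lemma free_map_superset:
  assumes "finite S" "Poly_Mapping.keys x \<subseteq> S"
  shows "free_map f x = (\<Sum>v\<in>S. Poly_Mapping.single (f v) (Poly_Mapping.lookup x v))"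
  unfolding free_map_def by (rule sum.mono_neutral_left) (use assms in \<open>auto simp: in_keys_iff\<close>)

lemma linear_free_map:
  "Vector_Spaces.linear ac_smult ac_smult (free_map f :: ('v \<Rightarrow>\<^sub>0 'e::field) \<Rightarrow> ('w \<Rightarrow>\<^sub>0 'e))"
  unfolding Vector_Spaces.linear_iff
proof (intro conjI allI)
  fix x y :: "'v \<Rightarrow>\<^sub>0 'e" and c :: 'e
  let ?S = "Poly_Mapping.keys x \<union> Poly_Mapping.keys y"
  have fin: "finite ?S" by simp
  have "Poly_Mapping.keys (x + y) \<subseteq> ?S" by (rule Poly_Mapping.keys_add)
  then show "free_map f (x + y) = free_map f x + free_map f y"
    by (simp add: free_map_superset[OF fin] lookup_add single_add sum.distrib)
  have "Poly_Mapping.keys (ac_smult c x) \<subseteq> Poly_Mapping.keys x"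
    by (auto simp: in_keys_iff lookup_ac_smult)
  then show "free_map f (ac_smult c x) = ac_smult c (free_map f x)"
    by (simp add: free_map_superset[OF finite_keys] free_map_def[of f x] ac.scale_sum_right
        lookup_ac_smult ac_smult_single)
qed (rule ac.vector_space_axioms)+

lemma free_map_single: "free_map f (Poly_Mapping.single v c) = Poly_Mapping.single (f v) c"
  by (simp add: free_map_def)

lemma free_map_comp:
  "free_map f (free_map g (x :: _ \<Rightarrow>\<^sub>0 'e::field)) = free_map (\<lambda>v. f (g v)) x"
proof -
  interpret f: Vector_Spaces.linear ac_smult ac_smult "free_map f :: (_ \<Rightarrow>\<^sub>0 'e) \<Rightarrow> _"
    by (rule linear_free_map)
  show ?thesis
    by (simp add: free_map_def[of g] free_map_def[of "\<lambda>v. f (g v)"] f.sum free_map_single)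
qed

lemma poly_mapping_eq_sum_smult:
  "x = (\<Sum>v\<in>Poly_Mapping.keys x.
     ac_smult (Poly_Mapping.lookup x v) (Poly_Mapping.single v (1 :: 'e::field)))"
  by (intro poly_mapping_eqI)
     (simp add: ac_smult_single lookup_sum lookup_single when_def in_keys_iff)

lemma subspace_tensor_kernel: "ac.subspace (tensor_kernel scale)"
  unfolding tensor_kernel_def by (rule ac.subspace_span)

lemma tensor_kernel_add:
  "Poly_Mapping.single (v + w) 1 - Poly_Mapping.single v 1 - Poly_Mapping.single w 1
     \<in> tensor_kernel scale"
  unfolding tensor_kernel_def by (rule ac.span_base) blast

lemma tensor_kernel_scale:
  "Poly_Mapping.single (scale a v) 1 - Poly_Mapping.single v (to_ac a) \<in> tensor_kernel scale"
  unfolding tensor_kernel_def by (rule ac.span_base) blast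

lemma tensor_kernel_least:
  assumes "ac.subspace W"
    and "\<And>v w. Poly_Mapping.single (v + w) 1 - Poly_Mapping.single v 1 - Poly_Mapping.single w 1 \<in> W"
    and "\<And>a v. Poly_Mapping.single (scale a v) 1 - Poly_Mapping.single v (to_ac a) \<in> W"
  shows "tensor_kernel scale \<subseteq> W"
  unfolding tensor_kernel_def by (rule ac.span_minimal) (use assms in auto)

lemma single_zero_tensor_kernel: "Poly_Mapping.single 0 1 \<in> tensor_kernel scale"
  using ac.subspace_neg[OF subspace_tensor_kernel tensor_kernel_add[of 0 0 scale]]
  by (simp del: single_one)

text \<open>An R-linear combination in V agrees, modulo the bilinearity relations, with the same
  combination formed over the algebraic closure. This carries a polynomial relation for an operator
  on V over to the scalar extension.\<close>

lemma single_sum_tensor_kernel: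
  assumes "finite I"
  shows "Poly_Mapping.single (\<Sum>i\<in>I. scale (c i) (w i)) 1 -
      (\<Sum>i\<in>I. ac_smult (to_ac (c i)) (Poly_Mapping.single (w i) 1)) \<in> tensor_kernel scale"
  using assms
proof (induction I)
  case empty
  show ?case by (simp add: single_zero_tensor_kernel del: single_one)
next
  case (insert i I)
  let ?v = "scale (c i) (w i)" and ?s = "\<Sum>i\<in>I. scale (c i) (w i)"
  let ?S = "\<Sum>i\<in>I. ac_smult (to_ac (c i)) (Poly_Mapping.single (w i) 1)"
  have "(Poly_Mapping.single (?v + ?s) 1 - Poly_Mapping.single ?v 1 - Poly_Mapping.single ?s 1) +
      (Poly_Mapping.single ?v 1 - Poly_Mapping.single (w i) (to_ac (c i))) +
      (Poly_Mapping.single ?s 1 - ?S) \<in> tensor_kernel scale"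
    by (intro ac.subspace_add[OF subspace_tensor_kernel] tensor_kernel_add tensor_kernel_scale
        insert.IH)
  then show ?case using insert.hyps by (simp add: ac_smult_single algebra_simps)
qed

text \<open>Linearity of \<open>A\<close> turns each bilinearity relation into another one of the
  same shape, so \<open>A\<close> induces an operator on the scalar extension.\<close>

lemma free_map_tensor_kernel:
  assumes "Vector_Spaces.linear scale scale A" "x \<in> tensor_kernel scale"
  shows "free_map A x \<in> tensor_kernel scale"
proof -
  interpret A: Vector_Spaces.linear scale scale A by fact
  interpret fA: Vector_Spaces.linear ac_smult ac_smult
    "free_map A :: (_ \<Rightarrow>\<^sub>0 'a alg_closure) \<Rightarrow> _"
    by (rule linear_free_map)
  have "tensor_kernel scale \<subseteq> free_map A -` tensor_kernel scale"
    by (rule tensor_kernel_least)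
       (simp_all add: fA.subspace_vimage subspace_tensor_kernel fA.diff free_map_single A.add
         A.scale tensor_kernel_add tensor_kernel_scale)
  then show ?thesis using assms(2) by auto
qed

section \<open>Linear forms on the scalar extension\<close>

definition ac_functional :: "('v \<Rightarrow> 'r::field) \<Rightarrow> ('v \<Rightarrow>\<^sub>0 'r alg_closure) \<Rightarrow> 'r alg_closure" where
  "ac_functional \<xi> x = (\<Sum>v\<in>Poly_Mapping.keys x. Poly_Mapping.lookup x v * to_ac (\<xi> v))"

lemma ac_functional_superset:
  assumes "finite S" "Poly_Mapping.keys x \<subseteq> S"
  shows "ac_functional \<xi> x = (\<Sum>v\<in>S. Poly_Mapping.lookup x v * to_ac (\<xi> v))"
  unfolding ac_functional_def
  by (rule sum.mono_neutral_left) (use assms in \<open>auto simp: in_keys_iff\<close>)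

lemma ac_functional_single: "ac_functional \<xi> (Poly_Mapping.single v c) = c * to_ac (\<xi> v)"
  by (simp add: ac_functional_def)

lemma linear_ac_functional: "Vector_Spaces.linear ac_smult (*) (ac_functional \<xi>)"
  unfolding Vector_Spaces.linear_iff
proof (intro conjI allI)
  fix x y :: "'b \<Rightarrow>\<^sub>0 'a alg_closure" and c
  let ?S = "Poly_Mapping.keys x \<union> Poly_Mapping.keys y"
  have fin: "finite ?S" by simp
  have "Poly_Mapping.keys (x + y) \<subseteq> ?S" by (rule Poly_Mapping.keys_add)
  then show "ac_functional \<xi> (x + y) = ac_functional \<xi> x + ac_functional \<xi> y"
    by (simp add: ac_functional_superset[OF fin] lookup_add sum.distrib algebra_simps)
  have "Poly_Mapping.keys (ac_smult c x) \<subseteq> Poly_Mapping.keys x"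
    by (auto simp: in_keys_iff lookup_ac_smult)
  then show "ac_functional \<xi> (ac_smult c x) = c * ac_functional \<xi> x"
    by (simp add: ac_functional_superset[OF finite_keys] ac_functional_def[of \<xi> x]
        sum_distrib_left lookup_ac_smult mult.assoc)
qed (unfold_locales; simp add: algebra_simps)+

text \<open>The extended form kills the generating relations and so descends to the quotient. It is
  the means of returning from the algebraic closure to V.\<close>

lemma ac_functional_tensor_kernel:
  assumes "Vector_Spaces.linear scale (*) \<xi>" "x \<in> tensor_kernel scale"
  shows "ac_functional \<xi> x = 0"
proof -
  interpret \<xi>: Vector_Spaces.linear scale "(*)" \<xi> by fact
  interpret \<Xi>: Vector_Spaces.linear ac_smult "(*)" "ac_functional \<xi>"
    by (rule linear_ac_functional)
  have "tensor_kernel scale \<subseteq> {x. ac_functional \<xi> x = 0}"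
    by (rule tensor_kernel_least)
       (simp_all add: \<Xi>.subspace_kernel \<Xi>.diff ac_functional_single \<xi>.add \<xi>.scale)
  then show ?thesis using assms(2) by auto
qed

section \<open>Schur's lemma\<close>

text \<open>Induction on the degree: a root \<mu> of p is split off, p = (X - \<mu>) q. Either T x -
  \<mu> x already lies in K, and x is the eigenvector, or it is a vector outside K which q(T) sends
  into K.\<close>

lemma exists_eigenvector_modulo_subspace:
  fixes scale :: "'e::alg_closed_field \<Rightarrow> 'w::ab_group_add \<Rightarrow> 'w"
  assumes T: "Vector_Spaces.linear scale scale T" and K: "module.subspace scale K"
    and "p \<noteq> 0" "x \<notin> K"
    and "(\<Sum>i\<le>degree p. scale (coeff p i) ((T ^^ i) x)) \<in> K"
  obtains \<mu> y where "y \<notin> K" "T y - scale \<mu> y \<in> K"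
proof -
  interpret T: Vector_Spaces.linear scale scale T by fact
  have T_pow: "(T ^^ i) (x - scale c y) = (T ^^ i) x - scale c ((T ^^ i) y)" for i x y c
    by (induction i) (simp_all add: T.diff T.scale)
  have "\<exists>\<mu> y. y \<notin> K \<and> T y - scale \<mu> y \<in> K" using assms(3-5)
  proof (induction "degree p" arbitrary: p x)
    \<comment> \<open>A nonzero constant c with c x in K would put x in K, so this case is
      contradictory.\<close>
    case 0
    then obtain c where p: "p = [:c:]" using degree0_coeffs by metis
    with 0 have "c \<noteq> 0" "scale c x \<in> K" by auto
    then have "scale (inverse c) (scale c x) \<in> K" using T.vs1.subspace_scale[OF K] by blast
    with \<open>c \<noteq> 0\<close> \<open>x \<notin> K\<close> show ?case by simp
  next
    case (Suc d)
    have "degree p > 0" using Suc.hyps(2) by simp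
    then obtain \<mu> where "poly p \<mu> = 0" using alg_closed_imp_poly_has_root by blast
    then obtain q where p: "p = [:-\<mu>, 1:] * q" by (auto simp: poly_eq_0_iff_dvd dvd_def)
    with Suc.prems have q: "q \<noteq> 0" by auto
    have deg: "degree p = Suc (degree q)"
      using degree_mult_eq[of "[:-\<mu>, 1:]" q] q p by (simp del: mult_pCons_left)
    with Suc.hyps have d: "d = degree q" by simp
    have coeff: "coeff p i = coeff (pCons 0 q) i - \<mu> * coeff q i" for i
      unfolding p by simp
    \<comment> \<open>This computation rewrites p(T) x as q(T) (T x - \<mu> x).\<close>
    have "(\<Sum>i\<le>degree p. scale (coeff p i) ((T ^^ i) x)) =
        (\<Sum>i\<le>Suc d. scale (coeff (pCons 0 q) i) ((T ^^ i) x)) -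
        (\<Sum>i\<le>Suc d. scale (\<mu> * coeff q i) ((T ^^ i) x))"
      unfolding coeff deg d by (simp only: T.vs1.scale_left_diff_distrib sum_subtractf)
    also have "(\<Sum>i\<le>Suc d. scale (coeff (pCons 0 q) i) ((T ^^ i) x)) =
        (\<Sum>i\<le>d. scale (coeff q i) ((T ^^ i) (T x)))"
      by (subst sum.atMost_Suc_shift) (simp add: funpow_swap1)
    also have "(\<Sum>i\<le>Suc d. scale (\<mu> * coeff q i) ((T ^^ i) x)) =
        (\<Sum>i\<le>d. scale (\<mu> * coeff q i) ((T ^^ i) x))"
      using d coeff_eq_0[of q "Suc d"] by simp
    also have "(\<Sum>i\<le>d. scale (coeff q i) ((T ^^ i) (T x))) - \<dots> =
        (\<Sum>i\<le>d. scale (coeff q i) ((T ^^ i) (T x - scale \<mu> x)))"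
      unfolding T_pow T.vs1.scale_right_diff_distrib
      by (simp add: sum_subtractf mult.commute)
    finally have "(\<Sum>i\<le>degree q. scale (coeff q i) ((T ^^ i) (T x - scale \<mu> x))) \<in> K"
      using Suc.prems d by simp
    with Suc.hyps(1)[OF d q] show ?case using Suc.prems by blast
  qed
  then show ?thesis using that by blast
qed

text \<open>The first \<open>card S + 1\<close> iterates of \<open>v\<close> lie in a space spanned
  by \<open>card S\<close> vectors, so some nontrivial combination of them vanishes; its
  coefficients are those of p.\<close>

lemma (in vector_space) exists_annihilating_poly:
  fixes A :: "'b \<Rightarrow> 'b"
  assumes "finite S" and "\<And>i. (A ^^ i) v \<in> span S"
  obtains p where "p \<noteq> 0" "(\<Sum>i\<le>degree p. scale (coeff p i) ((A ^^ i) v)) = 0"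
proof -
  define f where "f i = (A ^^ i) v" for i
  have "\<exists>N c. (\<Sum>i\<le>N. scale (c i) (f i)) = 0 \<and> (\<exists>i\<le>N. c i \<noteq> 0)"
  \<comment> \<open>Dependence is a notion for sets and does not see repetitions. Two equal iterates
    give the relation X^i - X^j directly.\<close>
  proof (cases "inj_on f {..card S}")
    case True
    have "dependent (f ` {..card S})"
    proof (rule ccontr)
      assume "independent (f ` {..card S})"
      then have "card (f ` {..card S}) \<le> card S"
        using independent_span_bound[OF assms(1)] assms(2) by (auto simp: f_def)
      then show False using True by (simp add: card_image)
    qed
    then obtain u where "\<exists>x\<in>f ` {..card S}. u x \<noteq> 0" "(\<Sum>x\<in>f ` {..card S}. scale (u x) x) = 0"
      using dependent_finite[of "f ` {..card S}"] by auto
    then show ?thesis using True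
      by (intro exI[of _ "card S"] exI[of _ "u \<circ> f"]) (auto simp: sum.reindex)
  next
    case False
    then obtain i j where ij: "i \<noteq> j" "f i = f j" by (auto simp: inj_on_def)
    define c :: "nat \<Rightarrow> 'a" where "c = (\<lambda>k. if k = i then 1 else if k = j then - 1 else 0)"
    have "(\<Sum>k\<le>max i j. scale (c k) (f k)) = (\<Sum>k\<in>{i, j}. scale (c k) (f k))"
      by (rule sum.mono_neutral_right) (auto simp: c_def)
    also have "\<dots> = 0" using ij by (simp add: c_def)
    finally show ?thesis
      by (intro exI[of _ "max i j"] exI[of _ c]) (auto simp: c_def intro!: exI[of _ i])
  qed
  then obtain N c i where c: "(\<Sum>i\<le>N. scale (c i) (f i)) = 0" "i \<le> N" "c i \<noteq> 0" by blast
  define p where "p = (\<Sum>i\<le>N. monom (c i) i)"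
  have coeff: "coeff p j = (if j \<le> N then c j else 0)" for j
    by (simp add: p_def coeff_sum)
  have "p \<noteq> 0" using coeff[of i] c by auto
  moreover have "(\<Sum>i\<le>degree p. scale (coeff p i) (f i)) = (\<Sum>i\<le>N. scale (c i) (f i))"
  proof -
    have "degree p \<le> N" by (rule degree_le) (simp add: coeff)
    then have "(\<Sum>i\<le>degree p. scale (coeff p i) (f i)) = (\<Sum>i\<le>N. scale (coeff p i) (f i))"
      by (intro sum.mono_neutral_left) (auto simp: coeff_eq_0)
    then show ?thesis by (simp add: coeff)
  qed
  ultimately show ?thesis using c that by (simp add: f_def)
qed

lemma (in vector_space) exists_functional_nonzero:
  assumes "v \<noteq> 0"
  obtains \<xi> where "Vector_Spaces.linear scale (*) \<xi>" "\<xi> v = 1"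
proof -
  interpret pair: vector_space_pair scale "(*) :: 'a \<Rightarrow> 'a \<Rightarrow> 'a"
    by unfold_locales (simp_all add: algebra_simps)
  have ind: "independent {v}" using assms by simp
  show ?thesis
    using that[OF pair.linear_construct[OF ind, of "\<lambda>_. 1"]] pair.construct_basis[OF ind, of v "\<lambda>_. 1"]
    by simp
qed

context group_representation
begin

text \<open>Finite dimension of V is not among the hypotheses. \<open>A_span\<close> keeps the
  iterates of \<open>A\<close> on one vector inside the span of a finite orbit, which yields an
  annihilating polynomial and hence an eigenvector over the algebraic closure. Its eigenspace is
  stable, so it is everything, and the eigenvalue is then shown to lie in R.\<close>

lemma schur:
  assumes irr: "absolutely_irreducible G scale \<pi>" and fin: "finite (carrier G)"
    and A: "Vector_Spaces.linear scale scale A"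
    and comm: "\<And>g v. g \<in> carrier G \<Longrightarrow> A (\<pi> g v) = \<pi> g (A v)"
    and A_span: "\<And>v. A v \<in> span ((\<lambda>g. \<pi> g v) ` carrier G)"
  obtains c where "\<And>v. A v = scale c v"
proof -
  let ?K = "tensor_kernel scale"
  interpret A: Vector_Spaces.linear scale scale A by fact
  interpret fA: Vector_Spaces.linear ac_smult ac_smult
    "free_map A :: (_ \<Rightarrow>\<^sub>0 'r alg_closure) \<Rightarrow> _"
    by (rule linear_free_map)
  note sub = subspace_tensor_kernel[of scale]
  obtain x where x: "x \<notin> ?K" using irr unfolding absolutely_irreducible_def by blast
  \<comment> \<open>The vectors \<open>Poly_Mapping.single v 1\<close> span the free space, so not
    all of them can lie in the proper subspace \<open>?K\<close>.\<close>
  obtain v0 where v0: "Poly_Mapping.single v0 1 \<notin> ?K"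
  proof (rule ccontr)
    assume "\<not> thesis"
    then have "\<And>v. Poly_Mapping.single v 1 \<in> ?K" using that by blast
    then have "(\<Sum>v\<in>Poly_Mapping.keys x.
        ac_smult (Poly_Mapping.lookup x v) (Poly_Mapping.single v 1)) \<in> ?K"
      by (intro ac.subspace_sum[OF sub] ac.subspace_scale[OF sub]) auto
    with x show False using poly_mapping_eq_sum_smult[of x] by simp
  qed
  define S where "S = (\<lambda>g. \<pi> g v0) ` carrier G"
  have S_stable: "\<pi> g w \<in> span S" if g: "g \<in> carrier G" and w: "w \<in> span S" for g w
  proof -
    interpret g: Vector_Spaces.linear scale scale "\<pi> g" by (rule linear[OF g])
    have "\<pi> g (\<pi> h v0) \<in> S" if h: "h \<in> carrier G" for h
      using g h by (auto simp: S_def simp flip: mult)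
    then have "\<pi> g ` S \<subseteq> S" by (auto simp: S_def)
    then have "\<pi> g ` span S \<subseteq> span S" unfolding g.span_image[symmetric] by (rule span_mono)
    with w show ?thesis by blast
  qed
  have pow: "(A ^^ i) v0 \<in> span S" for i
  proof (induction i)
    case 0
    show ?case using one one_closed by (auto simp: S_def intro!: span_base image_eqI[of _ _ \<one>])
  next
    case (Suc i)
    have "span ((\<lambda>g. \<pi> g ((A ^^ i) v0)) ` carrier G) \<subseteq> span S"
      by (intro span_minimal subspace_span) (use S_stable Suc in auto)
    with A_span show ?case by auto
  qed
  have "finite S" using fin by (simp add: S_def)
  then obtain p where p: "p \<noteq> 0" "(\<Sum>i\<le>degree p. scale (coeff p i) ((A ^^ i) v0)) = 0"
    using exists_annihilating_poly[OF _ pow] by blast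
  define q where "q = map_poly to_ac p"
  have deg: "degree q = degree p" unfolding q_def by (rule degree_map_poly) simp
  have cf: "coeff q i = to_ac (coeff p i)" for i by (simp add: q_def coeff_map_poly)
  have fpow: "(free_map A ^^ i) (Poly_Mapping.single v0 1) =
      Poly_Mapping.single ((A ^^ i) v0) (1 :: 'r alg_closure)" for i
    by (induction i) (simp_all add: free_map_single)
  \<comment> \<open>Since p(A) v0 = 0, the first term is the image of p(A) v0, while the sum is q
    applied to the extended operator at the image of v0.\<close>
  have "Poly_Mapping.single 0 1 - (\<Sum>i\<le>degree q. ac_smult (coeff q i)
      ((free_map A ^^ i) (Poly_Mapping.single v0 1))) \<in> ?K"
    unfolding fpow cf deg
    using single_sum_tensor_kernel[of "{..degree p}" scale "coeff p" "\<lambda>i. (A ^^ i) v0"] p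
    by (simp del: single_one)
  from ac.subspace_diff[OF sub single_zero_tensor_kernel this]
  have in_K: "(\<Sum>i\<le>degree q. ac_smult (coeff q i)
      ((free_map A ^^ i) (Poly_Mapping.single v0 1))) \<in> ?K"
    by simp
  have "q \<noteq> 0" using p cf[of "degree p"] by auto
  from exists_eigenvector_modulo_subspace[OF linear_free_map sub this v0 in_K]
  obtain \<mu> y where y: "y \<notin> ?K" "free_map A y - ac_smult \<mu> y \<in> ?K" .
  \<comment> \<open>This is the preimage in the free space of the \<mu>-eigenspace of the operator
    induced on the quotient. It contains \<open>y\<close>, hence differs from
    \<open>?K\<close>.\<close>
  define W where "W = {x. free_map A x - ac_smult \<mu> x \<in> ?K}"
  have sub_W: "ac.subspace W"
  proof -
    have "free_map A (x + z) - ac_smult \<mu> (x + z) \<in> ?K"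
      if "free_map A x - ac_smult \<mu> x \<in> ?K" "free_map A z - ac_smult \<mu> z \<in> ?K" for x z
      using ac.subspace_add[OF sub that] by (simp add: fA.add ac.scale_right_distrib algebra_simps)
    moreover have "free_map A (ac_smult c x) - ac_smult \<mu> (ac_smult c x) \<in> ?K"
      if "free_map A x - ac_smult \<mu> x \<in> ?K" for x c
      using ac.subspace_scale[OF sub that, of c]
      by (simp add: fA.scale ac.scale_right_diff_distrib mult.commute)
    ultimately show ?thesis
      by (auto simp: W_def ac.subspace_def fA.zero ac.subspace_0[OF sub])
  qed
  have K_W: "?K \<subseteq> W"
    using free_map_tensor_kernel[OF A] ac.subspace_diff[OF sub] ac.subspace_scale[OF sub]
    by (auto simp: W_def)
  have "free_map (\<pi> g) x \<in> W" if g: "g \<in> carrier G" and x: "x \<in> W" for g x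
  proof -
    interpret g: Vector_Spaces.linear ac_smult ac_smult
      "free_map (\<pi> g) :: (_ \<Rightarrow>\<^sub>0 'r alg_closure) \<Rightarrow> _"
      by (rule linear_free_map)
    have "free_map (\<pi> g) (free_map A x - ac_smult \<mu> x) \<in> ?K"
      using free_map_tensor_kernel[OF linear[OF g]] x by (simp add: W_def)
    then show ?thesis by (simp add: W_def g.diff g.scale free_map_comp comm[OF g])
  qed
  then have "W = UNIV"
    using irr sub_W K_W y unfolding absolutely_irreducible_def W_def by blast
  then have eig: "Poly_Mapping.single (A v) 1 - Poly_Mapping.single v \<mu> \<in> ?K" for v
    by (auto simp: W_def set_eq_iff free_map_single ac_smult_single
        dest: spec[of _ "Poly_Mapping.single v 1"])
  have functional: "to_ac (\<xi> (A v)) = \<mu> * to_ac (\<xi> v)"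
    if "Vector_Spaces.linear scale (*) \<xi>" for \<xi> v
  proof -
    interpret \<Xi>: Vector_Spaces.linear ac_smult "(*)" "ac_functional \<xi>"
      by (rule linear_ac_functional)
    show ?thesis
      using ac_functional_tensor_kernel[OF that eig[of v]]
      by (simp add: \<Xi>.diff ac_functional_single)
  qed
  have "v0 \<noteq> 0" using v0 single_zero_tensor_kernel by metis
  then obtain \<xi> where \<xi>: "Vector_Spaces.linear scale (*) \<xi>" "\<xi> v0 = 1"
    using exists_functional_nonzero by blast
  \<comment> \<open>A form with value 1 at \<open>v0\<close> exhibits \<mu> as the image of an
    element of R.\<close>
  define c where "c = \<xi> (A v0)"
  have \<mu>: "\<mu> = to_ac c" using functional[OF \<xi>(1), of v0] \<xi>(2) by (simp add: c_def)
  have "A v = scale c v" for v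
  proof (rule ccontr)
    assume "A v \<noteq> scale c v"
    then obtain \<eta> where \<eta>: "Vector_Spaces.linear scale (*) \<eta>" "\<eta> (A v - scale c v) = 1"
      using exists_functional_nonzero[of "A v - scale c v"] by auto
    interpret \<eta>: Vector_Spaces.linear scale "(*)" \<eta> by fact
    have "to_ac (\<eta> (A v)) = to_ac (c * \<eta> v)" using functional[OF \<eta>(1), of v] \<mu> by simp
    then have "\<eta> (A v) = c * \<eta> v" by (simp del: to_ac_mult)
    with \<eta>(2) show False by (simp add: \<eta>.diff \<eta>.scale)
  qed
  then show ?thesis using that by blast
qed

end

section \<open>Sums over cosets\<close>

text \<open>One representative is chosen in each right coset, which avoids division by the order of
  H. The value is independent of the choice when F is constant on right cosets.\<close>

definition coset_sum ::
    "('g, 'm) monoid_scheme \<Rightarrow> 'g set \<Rightarrow> ('g \<Rightarrow> 'r::comm_monoid_add) \<Rightarrow> 'r" where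
  "coset_sum G H F = (\<Sum>C\<in>rcosets\<^bsub>G\<^esub> H. F (SOME x. x \<in> C))"

lemma (in subgroup) rcosets_some_rep:
  assumes "group G" "C \<in> rcosets H"
  shows "(SOME x. x \<in> C) \<in> carrier G" "H #> (SOME x. x \<in> C) = C"
proof -
  interpret group G by fact
  have "(SOME x. x \<in> C) \<in> C"
    using rcosets_non_empty[OF assms(2)] by (simp add: some_in_eq)
  moreover obtain y where "y \<in> carrier G" "C = H #> y"
    using assms(2) by (auto simp: RCOSETS_def)
  ultimately show "(SOME x. x \<in> C) \<in> carrier G" "H #> (SOME x. x \<in> C) = C"
    using repr_independence[OF _ _ is_subgroup] r_coset_subset_G[OF subset] by blast+
qed

lemma coset_sum_add: "coset_sum G H (\<lambda>x. F x + F' x) = coset_sum G H F + coset_sum G H F'"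
  by (simp add: coset_sum_def sum.distrib)

lemma coset_sum_mult_left:
  "coset_sum G H (\<lambda>x. c * F x) = c * (coset_sum G H F :: 'r::semiring_0)"
  by (simp add: coset_sum_def sum_distrib_left)

lemma coset_sum_sum:
  "coset_sum G H (\<lambda>x. \<Sum>i\<in>I. F i x) = (\<Sum>i\<in>I. coset_sum G H (F i))"
  unfolding coset_sum_def by (rule sum.swap)

context group
begin

lemma coset_sum_cong:
  assumes "subgroup H G" "\<And>x. x \<in> carrier G \<Longrightarrow> F x = F' x"
  shows "coset_sum G H F = coset_sum G H F'"
  unfolding coset_sum_def
  by (rule sum.cong) (use subgroup.rcosets_some_rep[OF assms(1) is_group] assms(2) in auto)

text \<open>The right cosets partition the group, and h \<mapsto> h x is a bijection from H onto H
  x. F need not be constant on cosets: the inner sum takes care of that.\<close>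

lemma sum_eq_coset_sum:
  assumes H: "subgroup H G" and fin: "finite (carrier G)"
  shows "(\<Sum>x\<in>carrier G. f x) = coset_sum G H (\<lambda>x. \<Sum>h\<in>H. f (h \<otimes> x))"
proof -
  interpret H: subgroup H G by fact
  have "(\<Sum>x\<in>carrier G. f x) = (\<Sum>x\<in>\<Union>(rcosets H). f x)"
    by (simp add: rcosets_part_G[OF H])
  also have "\<dots> = (\<Sum>C\<in>rcosets H. \<Sum>x\<in>C. f x)"
  proof (rule sum.Union_disjoint[unfolded comp_def])
    show "\<forall>C\<in>rcosets H. finite C"
      using fin H.rcosets_carrier[OF is_group] finite_subset by metis
    show "\<forall>C\<in>rcosets H. \<forall>D\<in>rcosets H. C \<noteq> D \<longrightarrow> C \<inter> D = {}"
      using rcos_disjoint[OF H] by (auto simp: pairwise_def disjnt_def)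
  qed
  also have "\<dots> = coset_sum G H (\<lambda>x. \<Sum>h\<in>H. f (h \<otimes> x))"
    unfolding coset_sum_def
  proof (rule sum.cong[OF refl])
    fix C assume C: "C \<in> rcosets H"
    note rep = H.rcosets_some_rep[OF is_group C]
    let ?x = "SOME x. x \<in> C"
    have "C = (\<lambda>h. h \<otimes> ?x) ` H" using rep(2) by (auto simp: r_coset_def)
    moreover have "inj_on (\<lambda>h. h \<otimes> ?x) H" using rep(1) by (auto intro!: inj_onI)
    ultimately show "(\<Sum>x\<in>C. f x) = (\<Sum>h\<in>H. f (h \<otimes> ?x))"
      by (metis (no_types, lifting) sum.reindex_cong)
  qed
  finally show ?thesis .
qed

context
  fixes H and F :: "'a \<Rightarrow> 'r::comm_monoid_add"
  assumes H: "subgroup H G"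
    and F: "\<And>h x. h \<in> H \<Longrightarrow> x \<in> carrier G \<Longrightarrow> F (h \<otimes> x) = F x"
begin

interpretation H: subgroup H G by (rule H)

lemma invariant_same_coset:
  assumes "x \<in> carrier G" "y \<in> carrier G" "H #> x = H #> y"
  shows "F x = F y"
proof -
  have "x \<in> H #> y" using rcos_self[OF assms(1) H] assms(3) by simp
  then show ?thesis using F assms(2) by (auto simp: r_coset_def)
qed

text \<open>Right multiplication by y permutes the right cosets. The representative chosen in C y
  may differ from that of C times y, but both lie in the same coset, where F is constant.\<close>

lemma coset_sum_translate:
  assumes y: "y \<in> carrier G"
  shows "coset_sum G H (\<lambda>x. F (x \<otimes> y)) = coset_sum G H F"
  unfolding coset_sum_def
proof (rule sum.reindex_bij_witness[where i = "\<lambda>C. C #> inv y" and j = "\<lambda>C. C #> y"])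
  fix C assume C: "C \<in> rcosets H"
  then obtain x where x: "x \<in> carrier G" "C = H #> x" by (auto simp: RCOSETS_def)
  show "C #> y #> inv y = C" "C #> inv y #> y = C"
    using x y by (simp_all add: coset_mult_assoc H.subset m_assoc)
  show "C #> y \<in> rcosets H" "C #> inv y \<in> rcosets H"
    using x y by (auto simp: coset_mult_assoc H.subset intro!: rcosetsI)
  then have C': "C #> y \<in> rcosets H" by simp
  note rep = H.rcosets_some_rep[OF is_group C] and rep' = H.rcosets_some_rep[OF is_group C']
  show "F (SOME x. x \<in> C #> y) = F ((SOME x. x \<in> C) \<otimes> y)"
    by (rule invariant_same_coset)
       (use rep rep' y in \<open>simp_all add: H.subset flip: coset_mult_assoc\<close>)
qed

lemma coset_sum_single:
  assumes y: "y \<in> carrier G" and fin: "finite (carrier G)"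
    and zero: "\<And>x. x \<in> carrier G \<Longrightarrow> x \<notin> H #> y \<Longrightarrow> F x = 0"
  shows "coset_sum G H F = F y"
proof -
  have y_coset: "H #> y \<in> rcosets H" by (rule rcosetsI[OF H.subset y])
  have fin': "finite (rcosets H)"
    using fin by (auto simp: RCOSETS_def)
  have "F (SOME x. x \<in> C) = 0" if "C \<in> rcosets H - {H #> y}" for C
  proof (rule zero)
    note rep = H.rcosets_some_rep[OF is_group, of C]
    show "(SOME x. x \<in> C) \<in> carrier G" using rep that by auto
    show "(SOME x. x \<in> C) \<notin> H #> y"
      using rep that repr_independence[OF _ y H] by auto
  qed
  then have "coset_sum G H F = F (SOME x. x \<in> H #> y)"
    unfolding coset_sum_def
    using sum.remove[OF fin' y_coset, of "\<lambda>C. F (SOME x. x \<in> C)"] by simp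
  also have "\<dots> = F y"
    using H.rcosets_some_rep[OF is_group y_coset] y by (intro invariant_same_coset) auto
  finally show ?thesis .
qed

end

end

section \<open>General linear groups\<close>

lemma group_GL: "group (GL n :: 'k::field mat monoid)"
proof -
  interpret ring "ring_mat TYPE('k) n ()" by (rule ring_mat)
  show ?thesis unfolding GL_def by (rule units_group)
qed

lemma carrier_GL: "g \<in> carrier (GL n) \<longleftrightarrow> g \<in> carrier_mat n n \<and> det g \<noteq> (0 :: 'k::field)"
proof
  assume "g \<in> carrier (GL n)"
  then have "g \<in> Units (ring_mat TYPE('k) n ())" by (simp add: GL_def units_of_carrier)
  then show "g \<in> carrier_mat n n \<and> det g \<noteq> 0"
    using unit_imp_det_non_zero[of g n "()"] by (simp add: Units_def ring_mat_simps)
next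
  assume "g \<in> carrier_mat n n \<and> det g \<noteq> 0"
  then show "g \<in> carrier (GL n)"
    using det_non_zero_imp_unit[of g n "()"] by (simp add: GL_def units_of_carrier)
qed

lemma mult_GL [simp]: "monoid.mult (GL n) = (*)"
  by (simp add: GL_def units_of_mult ring_mat_simps)

lemma one_GL [simp]: "monoid.one (GL n) = 1\<^sub>m n"
  by (simp add: GL_def units_of_one ring_mat_simps)

lemma finite_carrier_mat: "finite (carrier_mat n m :: 'k::finite mat set)"
proof (rule finite_subset)
  show "(carrier_mat n m :: 'k mat set) \<subseteq> (\<lambda>f. mat n m f) ` (({..<n} \<times> {..<m}) \<rightarrow>\<^sub>E UNIV)"
  proof
    fix A :: "'k mat" assume A: "A \<in> carrier_mat n m"
    then have "A = mat n m (restrict (($$) A) ({..<n} \<times> {..<m}))" by (intro eq_matI) simp_all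
    then show "A \<in> (\<lambda>f. mat n m f) ` (({..<n} \<times> {..<m}) \<rightarrow>\<^sub>E UNIV)"
      by (rule image_eqI[where x = "restrict (($$) A) ({..<n} \<times> {..<m})"]) simp
  qed
  show "finite ((\<lambda>f. mat n m f) ` (({..<n} \<times> {..<m}) \<rightarrow>\<^sub>E (UNIV :: 'k set)))"
    by (intro finite_imageI finite_PiE finite_cartesian_product) simp_all
qed

lemma finite_GL: "finite (carrier (GL n :: 'k::{field,finite} mat monoid))"
  by (rule finite_subset[OF _ finite_carrier_mat[of n n]]) (auto simp: carrier_GL)

section \<open>Traces of products and scalar matrices\<close>

lemma mat_tr_mult:
  assumes "A \<in> carrier_mat n m" "B \<in> carrier_mat m n"
  shows "mat_tr (A * B) = (\<Sum>i<n. \<Sum>j<m. A $$ (i, j) * B $$ (j, i) :: 'k::comm_semiring_0)"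
  unfolding mat_tr_def
proof (rule sum.cong)
  show "{..<dim_row (A * B)} = {..<n}" using assms by simp
  fix i assume "i \<in> {..<n}"
  then show "(A * B) $$ (i, i) = (\<Sum>j<m. A $$ (i, j) * B $$ (j, i))"
    using assms by (simp add: scalar_prod_def atLeast0LessThan)
qed

lemma mat_tr_comm:
  assumes "A \<in> carrier_mat n m" "B \<in> carrier_mat m n"
  shows "mat_tr (A * B) = mat_tr (B * A :: 'k::comm_semiring_0 mat)"
  unfolding mat_tr_mult[OF assms] mat_tr_mult[OF assms(2,1)]
  by (subst sum.swap) (intro sum.cong refl mult.commute)

lemma scalar_mat_GL:
  assumes "z \<noteq> (0 :: 'k::field)"
  shows "z \<cdot>\<^sub>m 1\<^sub>m n \<in> carrier (GL n)"
  using assms by (simp add: carrier_GL det_smult)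

lemma inv_scalar_mat_GL:
  assumes "z \<noteq> (0 :: 'k::field)"
  shows "inv\<^bsub>GL n\<^esub> (z \<cdot>\<^sub>m 1\<^sub>m n) = inverse z \<cdot>\<^sub>m 1\<^sub>m n"
proof (rule group.inv_equality[OF group_GL])
  show "inverse z \<cdot>\<^sub>m 1\<^sub>m n \<otimes>\<^bsub>GL n\<^esub> (z \<cdot>\<^sub>m 1\<^sub>m n) = \<one>\<^bsub>GL n\<^esub>"
    using assms by (intro eq_matI) auto
qed (use assms scalar_mat_GL[of z n] scalar_mat_GL[of "inverse z" n] in auto)

lemma scalar_mat_mult:
  assumes "a \<in> carrier_mat n n"
  shows "(z \<cdot>\<^sub>m 1\<^sub>m n) * a = z \<cdot>\<^sub>m (a :: 'k::comm_ring_1 mat)" "a * (z \<cdot>\<^sub>m 1\<^sub>m n) = z \<cdot>\<^sub>m a"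
  using assms mult_smult_distrib[of a n n "1\<^sub>m n" n z] mult_smult_assoc_mat[of "1\<^sub>m n" n n a n z]
  by simp_all

section \<open>Unipotent radicals\<close>

text \<open>With w a nonzero vector of W, this shows that the stabilizer of W in GL is proper. A
  target z outside W is chosen so that a rank-one change of the identity carrying w to z is
  invertible.\<close>

lemma exists_GL_mapping_outside:
  fixes w y :: "'k::field vec"
  assumes w: "w \<in> carrier_vec n" "w \<noteq> 0\<^sub>v n" and y: "y \<in> carrier_vec n"
    and W: "\<And>t. y + t \<cdot>\<^sub>v w \<notin> W"
  obtains g where "g \<in> carrier (GL n)" "g *\<^sub>v w \<notin> W"
proof -
  from w obtain i where i: "i < n" "w $ i \<noteq> 0" by (auto simp: vec_eq_iff)
  \<comment> \<open>Adding w when y has vanishing i-th coordinate makes that coordinate of z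
    nonzero; the hypothesis on W keeps z outside W.\<close>
  define z where "z = y + (if y $ i = 0 then 1 else 0) \<cdot>\<^sub>v w"
  have z: "z \<in> carrier_vec n" "z $ i \<noteq> 0" "z \<notin> W"
    using w y i W by (auto simp: z_def)
  \<comment> \<open>This is the identity plus the column (z - w) / w_i placed in position i. It maps
    w to z, and a kernel vector x satisfies x_i z_i = 0, which forces x = 0.\<close>
  define g where "g = mat n n
    (\<lambda>(r, c). (if r = c then 1 else 0) + (if c = i then (z $ r - w $ r) / w $ i else 0))"
  have g: "g \<in> carrier_mat n n" by (simp add: g_def)
  have g_apply: "(g *\<^sub>v x) $ r = x $ r + (z $ r - w $ r) / w $ i * x $ i"
    if "x \<in> carrier_vec n" "r < n" for x r
  proof -
    have "(g *\<^sub>v x) $ r = (\<Sum>c<n. ((if r = c then 1 else 0) +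
        (if c = i then (z $ r - w $ r) / w $ i else 0)) * x $ c)"
      using that by (simp add: g_def scalar_prod_def atLeast0LessThan)
    also have "\<dots> = (\<Sum>c<n. (if r = c then x $ c else 0) +
        (if c = i then (z $ r - w $ r) / w $ i * x $ c else 0))"
      by (rule sum.cong) (auto simp: algebra_simps)
    finally show ?thesis using that i by (simp add: sum.distrib)
  qed
  have "x = 0\<^sub>v n" if x: "x \<in> carrier_vec n" "g *\<^sub>v x = 0\<^sub>v n" for x
  proof -
    have "x $ i + (z $ i - w $ i) / w $ i * x $ i = 0" using g_apply[OF x(1) i(1)] x(2) i by simp
    then have "x $ i * z $ i = 0" using i by (simp add: field_simps)
    then have "x $ i = 0" using z by simp
    then show ?thesis using g_apply[OF x(1)] x by (intro eq_vecI) auto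
  qed
  then have "det g \<noteq> 0" using det_0_iff_vec_prod_zero_field[OF g] by auto
  then have "g \<in> carrier (GL n)" using g by (simp add: carrier_GL)
  moreover have "g *\<^sub>v w = z"
    using g_apply[OF w(1)] w g z i by (intro eq_vecI) auto
  ultimately show ?thesis using that z by simp
qed

lemma subspace_module_vecI:
  assumes "W \<subseteq> carrier_vec n" "0\<^sub>v n \<in> W"
    and "\<And>x y. x \<in> W \<Longrightarrow> y \<in> W \<Longrightarrow> x + y \<in> W" and "\<And>c x. x \<in> W \<Longrightarrow> c \<cdot>\<^sub>v x \<in> W"
  shows "VectorSpace.subspace class_ring W (module_vec TYPE('k::field) n)"
  unfolding subspace_def submodule_def
  using assms vec_vs[of n] vec_module[of n] by (auto simp: module_vec_simps class_ring_simps)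

text \<open>The kernel of a nonzero singular matrix is a proper nonzero subspace, so together with
  the two trivial subspaces it forms a flag with proper stabilizer, to which cuspidality
  applies.\<close>

lemma cuspidal_kernel_flag:
  fixes b :: "'k::field mat"
  assumes cusp: "cuspidal n scale \<pi>"
    and b: "b \<in> carrier_mat n n" "det b = 0" "b \<noteq> 0\<^sub>m n n"
  shows "coinvariant_kernel scale \<pi>
    (unipotent_radical n [{0\<^sub>v n}, mat_kernel b, carrier_vec n]) = UNIV"
proof -
  let ?W = "mat_kernel b"
  note W = mat_kernel[OF b(1)]
  obtain w where w: "w \<in> carrier_vec n" "w \<noteq> 0\<^sub>v n" "b *\<^sub>v w = 0\<^sub>v n"
    using det_0_iff_vec_prod_zero_field[OF b(1)] b(2) by blast
  obtain i j where ij: "i < n" "j < n" "b $$ (i, j) \<noteq> 0"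
    using b by (auto simp: mat_eq_iff)
  have "b *\<^sub>v unit_vec n j \<noteq> 0\<^sub>v n"
  proof
    assume "b *\<^sub>v unit_vec n j = 0\<^sub>v n"
    then have "(b *\<^sub>v unit_vec n j) $ i = 0" using ij by simp
    with ij b show False by (simp add: scalar_prod_right_unit)
  qed
  note bj = this
  \<comment> \<open>Since b w = 0, the matrix b sends this vector to its j-th column, which is
    nonzero.\<close>
  have y: "unit_vec n j + t \<cdot>\<^sub>v w \<notin> ?W" for t
  proof -
    have "t \<cdot>\<^sub>v 0\<^sub>v n = 0\<^sub>v n" by (intro eq_vecI) simp_all
    then show ?thesis
      using w b bj by (simp add: W mult_add_distrib_mat_vec[OF b(1)] mult_mat_vec[OF b(1)])
  qed
  obtain g where g: "g \<in> carrier (GL n)" "g *\<^sub>v w \<notin> ?W"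
    using exists_GL_mapping_outside[OF w(1,2) _ y] by auto
  have "is_flag n [{0\<^sub>v n}, ?W, carrier_vec n]"
    unfolding is_flag_def
  proof (intro conjI)
    show "\<forall>U\<in>set [{0\<^sub>v n}, ?W, carrier_vec n].
        VectorSpace.subspace class_ring U (module_vec TYPE('k) n)"
      using b by (auto intro!: subspace_module_vecI simp: W mult_add_distrib_mat_vec[OF b(1)]
          mult_mat_vec[OF b(1)])
    have "w \<in> ?W" "unit_vec n j \<notin> ?W" "?W \<subseteq> carrier_vec n" "0\<^sub>v n \<in> ?W"
      using w bj b(1) by (auto simp: W)
    then show "sorted_wrt (\<subset>) [{0\<^sub>v n}, ?W, carrier_vec n]"
      using w(2) unit_vec_carrier[of n j, where ?'a = 'k] by auto
  qed auto
  moreover have "parabolic n [{0\<^sub>v n}, ?W, carrier_vec n] \<noteq> carrier (GL n)"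
    using g w by (auto simp: parabolic_def W)
  ultimately show ?thesis using cusp by (auto simp: cuspidal_def)
qed

text \<open>For every x the vector u x - x lies in the kernel of b, hence in that of a, so a u x = a
  x.\<close>

lemma mult_unipotent_radical:
  fixes a b :: "'k::field mat"
  assumes a: "a \<in> carrier_mat n n" and b: "b \<in> carrier_mat n n" "mat_kernel b \<subseteq> mat_kernel a"
    and u: "u \<in> unipotent_radical n [{0\<^sub>v n}, mat_kernel b, carrier_vec n]"
  shows "a * u = a"
proof -
  have u': "u \<in> carrier_mat n n" using u by (auto simp: unipotent_radical_def carrier_GL)
  have "a *\<^sub>v (u *\<^sub>v x) = a *\<^sub>v x" if x: "x \<in> carrier_vec n" for x
  proof -
    have "u *\<^sub>v x - x \<in> mat_kernel b"
      using u x by (auto simp: unipotent_radical_def dest!: spec[of _ 1])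
    then have "a *\<^sub>v (u *\<^sub>v x - x) = 0\<^sub>v n" using b a by (auto simp: mat_kernel)
    then have "a *\<^sub>v (u *\<^sub>v x) - a *\<^sub>v x = 0\<^sub>v n"
      using a u' x by (simp add: mult_minus_distrib_mat_vec[OF a])
    then show ?thesis using a u' x by (auto simp: vec_eq_iff)
  qed
  then have eq: "(a * u) *\<^sub>v x = a *\<^sub>v x" if "x \<in> carrier_vec n" for x
    using that a u' by simp
  show ?thesis
  proof (rule eq_matI)
    fix i j assume ij: "i < dim_row a" "j < dim_col a"
    have "((a * u) *\<^sub>v unit_vec n j) $ i = (a *\<^sub>v unit_vec n j) $ i"
      by (simp only: eq unit_vec_carrier)
    then show "(a * u) $$ (i, j) = a $$ (i, j)"
      using ij a u' by (simp del: assoc_mult_mat_vec)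
  qed (use a u' in auto)
qed

section \<open>Sums over cosets of a distinguishing subgroup\<close>

locale gl_representation =
  group_representation "GL n" scale \<pi>
  for n :: nat and scale :: "'r::field \<Rightarrow> 'v::ab_group_add \<Rightarrow> 'v"
    and \<pi> :: "'k::{field,finite} mat \<Rightarrow> 'v \<Rightarrow> 'v" +
  fixes H :: "'k mat set" and \<xi> :: "'v \<Rightarrow> 'r"
  assumes H_subgroup: "subgroup H (GL n)"
    and linear_\<xi>: "Vector_Spaces.linear scale (*) \<xi>"
    and invariant: "h \<in> H \<Longrightarrow> \<xi> (\<pi> h v) = \<xi> v"
begin

abbreviation ginv :: "'k mat \<Rightarrow> 'k mat" where "ginv x \<equiv> inv\<^bsub>GL n\<^esub> x"

interpretation \<xi>: Vector_Spaces.linear scale "(*)" \<xi> by (rule linear_\<xi>)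

lemma GL_carrier_mat: "x \<in> carrier (GL n) \<Longrightarrow> x \<in> carrier_mat n n"
  by (simp add: carrier_GL)

lemma H_GL: "h \<in> H \<Longrightarrow> h \<in> carrier (GL n)"
  using H_subgroup by (rule subgroup.mem_carrier)

lemma H_ginv: "h \<in> H \<Longrightarrow> ginv h \<in> H"
  using H_subgroup by (rule subgroup.m_inv_closed)

lemma ginv_mult:
  "x \<in> carrier (GL n) \<Longrightarrow> y \<in> carrier (GL n) \<Longrightarrow> ginv (x * y) = ginv y * ginv x"
  using inv_mult_group[of x y] by simp

lemma ginv_cancel:
  assumes "x \<in> carrier (GL n)" "a \<in> carrier_mat n n"
  shows "ginv x * (x * a) = a" "x * (ginv x * a) = a"
  using assms l_inv[OF assms(1)] r_inv[OF assms(1)] GL_carrier_mat[OF inv_closed[OF assms(1)]]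
  by (simp_all add: GL_carrier_mat flip: assoc_mult_mat[of _ n n _ n _ n])

text \<open>For \<open>S = H\<close> this is the total contribution of the coset H x to the Gauss
  sum, after inverting the summation variable. Other sets \<open>S\<close> allow singular matrices
  to be adjoined.\<close>

definition twisted :: "('k \<Rightarrow> 'r) \<Rightarrow> 'k mat set \<Rightarrow> 'v \<Rightarrow> 'k mat \<Rightarrow> 'r" where
  "twisted \<chi> S v x = (\<Sum>a\<in>S. \<chi> (mat_tr (ginv x * a))) * \<xi> (\<pi> x v)"

text \<open>The substitution a \<mapsto> h a permutes S and cancels the inverse of h coming from the
  inverse of h x; the factor in \<xi> is unchanged by H-invariance.\<close>

lemma twisted_invariant:
  assumes S: "S \<subseteq> carrier_mat n n" and HS: "\<And>h a. h \<in> H \<Longrightarrow> a \<in> S \<Longrightarrow> h * a \<in> S"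
    and h: "h \<in> H" and x: "x \<in> carrier (GL n)"
  shows "twisted \<chi> S v (h * x) = twisted \<chi> S v x"
proof -
  note h' = H_GL[OF h]
  note mats = GL_carrier_mat[OF h'] GL_carrier_mat[OF x] GL_carrier_mat[OF inv_closed[OF h']]
    GL_carrier_mat[OF inv_closed[OF x]]
  have "(\<Sum>a\<in>S. \<chi> (mat_tr (ginv (h * x) * a))) = (\<Sum>a\<in>S. \<chi> (mat_tr (ginv x * a)))"
  proof (rule sum.reindex_bij_witness[where i = "\<lambda>a. h * a" and j = "\<lambda>a. ginv h * a"])
    fix a assume a: "a \<in> S"
    then have a': "a \<in> carrier_mat n n" using S by auto
    show "h * (ginv h * a) = a" "ginv h * (h * a) = a" using ginv_cancel[OF h' a'] by auto
    show "ginv h * a \<in> S" "h * a \<in> S" using HS[OF _ a] h H_ginv by auto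
    show "\<chi> (mat_tr (ginv x * (ginv h * a))) = \<chi> (mat_tr (ginv (h * x) * a))"
      using mats a' by (simp add: ginv_mult[OF h' x] assoc_mult_mat[of _ n n _ n _ n])
  qed
  moreover have "\<xi> (\<pi> (h * x) v) = \<xi> (\<pi> x v)"
    using mult[OF h' x, of v] invariant[OF h] by simp
  ultimately show ?thesis by (simp add: twisted_def)
qed

text \<open>The substitution \<open>x \<mapsto> x u\<close> shows that the sum is a \<open>U\<close>-invariant functional of \<open>v\<close>, hence
  factors through the coinvariants.\<close>

lemma coset_sum_twisted_eq_zero:
  assumes S: "S \<subseteq> carrier_mat n n" and HS: "\<And>h a. h \<in> H \<Longrightarrow> a \<in> S \<Longrightarrow> h * a \<in> S"
    and U: "U \<subseteq> carrier (GL n)" and SU: "\<And>a u. a \<in> S \<Longrightarrow> u \<in> U \<Longrightarrow> a * u = a"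
    and coinv: "coinvariant_kernel scale \<pi> U = UNIV"
  shows "coset_sum (GL n) H (twisted \<chi> S v) = 0"
proof -
  define T where "T v = coset_sum (GL n) H (twisted \<chi> S v)" for v
  have add: "T (v + w) = T v + T w" for v w
    unfolding T_def coset_sum_add[symmetric]
  proof (rule coset_sum_cong[OF H_subgroup])
    fix x :: "'k mat" assume x: "x \<in> carrier (GL n)"
    interpret x: Vector_Spaces.linear scale scale "\<pi> x" by (rule linear[OF x])
    show "twisted \<chi> S (v + w) x = twisted \<chi> S v x + twisted \<chi> S w x"
      by (simp only: twisted_def x.add \<xi>.add distrib_left)
  qed
  have smult: "T (scale c v) = c * T v" for c v
    unfolding T_def coset_sum_mult_left[symmetric]
  proof (rule coset_sum_cong[OF H_subgroup])
    fix x :: "'k mat" assume x: "x \<in> carrier (GL n)"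
    interpret x: Vector_Spaces.linear scale scale "\<pi> x" by (rule linear[OF x])
    show "twisted \<chi> S (scale c v) x = c * twisted \<chi> S v x"
      by (simp only: twisted_def x.scale \<xi>.scale mult.left_commute)
  qed
  have inv_U: "T (\<pi> u v) = T v" if u: "u \<in> U" for u v
  proof -
    have u': "u \<in> carrier (GL n)" using u U by auto
    note u_mats = GL_carrier_mat[OF u'] GL_carrier_mat[OF inv_closed[OF u']]
    have Su: "a * ginv u = a" if "a \<in> S" for a
    proof -
      have a: "a \<in> carrier_mat n n" using that S by auto
      have "a * ginv u = (a * u) * ginv u" using SU[OF that u] by simp
      also have "\<dots> = a * (u * ginv u)" using a u_mats by (simp add: assoc_mult_mat[of _ n n _ n _ n])
      also have "\<dots> = a" using a r_inv[OF u'] by simp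
      finally show ?thesis .
    qed
    have "T (\<pi> u v) = coset_sum (GL n) H (\<lambda>x. twisted \<chi> S v (x \<otimes>\<^bsub>GL n\<^esub> u))"
      unfolding T_def
    proof (rule coset_sum_cong[OF H_subgroup])
      fix x :: "'k mat" assume x: "x \<in> carrier (GL n)"
      note mats = u_mats GL_carrier_mat[OF x] GL_carrier_mat[OF inv_closed[OF x]]
      \<comment> \<open>Cyclicity of the trace moves the inverse of u to the right of a, where it is
        absorbed.\<close>
      have "mat_tr (ginv (x * u) * a) = mat_tr (ginv x * a)" if "a \<in> S" for a
      proof -
        have a: "a \<in> carrier_mat n n" using that S by auto
        have "mat_tr (ginv (x * u) * a) = mat_tr (ginv u * (ginv x * a))"
          using mats a by (simp add: ginv_mult[OF x u'] assoc_mult_mat[of _ n n _ n _ n])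
        also have "\<dots> = mat_tr (ginv x * a * ginv u)"
          using mats a by (intro mat_tr_comm[of _ n n]) auto
        also have "\<dots> = mat_tr (ginv x * (a * ginv u))"
          using mats a by (simp add: assoc_mult_mat[of _ n n _ n _ n])
        finally show ?thesis by (simp add: Su[OF that])
      qed
      then show "twisted \<chi> S (\<pi> u v) x = twisted \<chi> S v (x \<otimes>\<^bsub>GL n\<^esub> u)"
        using mult[OF x u', of v] by (simp add: twisted_def)
    qed
    also have "\<dots> = T v"
      unfolding T_def
    proof (rule coset_sum_translate[OF H_subgroup _ u'])
      fix h x :: "'k mat" assume "h \<in> H" "x \<in> carrier (GL n)"
      then show "twisted \<chi> S v (h \<otimes>\<^bsub>GL n\<^esub> x) = twisted \<chi> S v x"
        using twisted_invariant[OF S HS, of h x] by simp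
    qed
    finally show ?thesis .
  qed
  have T_minus: "T (v - w) = T v - T w" for v w
    using add[of "v - w" w] by simp
  have T0: "T 0 = 0" using smult[of 0 0] by simp
  \<comment> \<open>The zero set of \<open>T\<close> is a subspace containing every \<pi> u v - v,
    so it contains the coinvariant kernel, which is all of V.\<close>
  have "subspace {v. T v = 0}" by (simp add: subspace_def add smult T0)
  then have "coinvariant_kernel scale \<pi> U \<subseteq> {v. T v = 0}"
    unfolding coinvariant_kernel_def by (intro span_minimal) (auto simp: T_minus inv_U)
  then have T: "T v = 0" unfolding coinv by auto
  show ?thesis using T unfolding T_def .
qed

text \<open>The singular matrices are grouped by their kernels, since those with a given kernel are all
  fixed by right multiplication with a common unipotent radical.\<close>

lemma coset_sum_singular_eq_zero:
  assumes cusp: "cuspidal n scale \<pi>" and n: "n \<ge> 2"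
    and S: "S \<subseteq> {a \<in> carrier_mat n n. det a = 0}"
    and HS: "\<And>h a. h \<in> H \<Longrightarrow> a \<in> S \<Longrightarrow> h * a \<in> S"
  shows "coset_sum (GL n) H (twisted \<chi> S v) = 0"
proof -
  define S' where "S' K = {a \<in> S. mat_kernel a = K}" for K
  have S_mat: "S \<subseteq> carrier_mat n n" using S by auto
  have fin: "finite S" using finite_subset[OF S_mat finite_carrier_mat] .
  have "twisted \<chi> S v = (\<lambda>x. \<Sum>K\<in>mat_kernel ` S. twisted \<chi> (S' K) v x)"
    unfolding twisted_def S'_def sum_distrib_right[symmetric]
    by (subst sum.image_gen[OF fin, of _ mat_kernel]) simp
  then have "coset_sum (GL n) H (twisted \<chi> S v) =
      (\<Sum>K\<in>mat_kernel ` S. coset_sum (GL n) H (twisted \<chi> (S' K) v))"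
    by (simp only: coset_sum_sum)
  also have "\<dots> = 0"
  proof (rule sum.neutral, rule ballI)
    fix K assume "K \<in> mat_kernel ` S"
    then obtain a where a: "a \<in> S" "mat_kernel a = K" by auto
    have a_mat: "a \<in> carrier_mat n n" "det a = 0" using a S by auto
    \<comment> \<open>The zero matrix has the whole space as kernel, which gives no proper
      parabolic. There b is the matrix unit in position (0, 0), which is singular because n \<ge> 2;
      any smaller kernel serves as well.\<close>
    obtain b :: "'k mat" where b: "b \<in> carrier_mat n n" "det b = 0" "b \<noteq> 0\<^sub>m n n"
      "mat_kernel b \<subseteq> K"
    proof (cases "a = 0\<^sub>m n n")
      case False
      then show ?thesis using that a a_mat by blast
    next
      case True
      define b :: "'k mat" where "b = mat n n (\<lambda>(i, j). if i = 0 \<and> j = 0 then 1 else 0)"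
      have b: "b \<in> carrier_mat n n" by (simp add: b_def)
      have "b *\<^sub>v unit_vec n 1 = 0\<^sub>v n"
        using n by (intro eq_vecI) (auto simp: b_def)
      then have "det b = 0"
        using det_0_iff_vec_prod_zero_field[OF b] n unit_vec_nonzero[of 1 n]
        by (metis One_nat_def Suc_1 Suc_le_lessD unit_vec_carrier)
      moreover have "b $$ (0, 0) \<noteq> 0\<^sub>m n n $$ (0, 0)" using n by (simp add: b_def)
      then have "b \<noteq> 0\<^sub>m n n" by auto
      moreover have "mat_kernel b \<subseteq> K"
        using a(2) True b by (auto simp: mat_kernel mat_kernel[of "0\<^sub>m n n" n n])
      ultimately show ?thesis using that b by blast
    qed
    let ?U = "unipotent_radical n [{0\<^sub>v n}, mat_kernel b, carrier_vec n]"
    show "coset_sum (GL n) H (twisted \<chi> (S' K) v) = 0"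
    proof (rule coset_sum_twisted_eq_zero)
      show "S' K \<subseteq> carrier_mat n n" using S_mat by (auto simp: S'_def)
      show "?U \<subseteq> carrier (GL n)" by (auto simp: unipotent_radical_def)
      show "coinvariant_kernel scale \<pi> ?U = UNIV"
        by (rule cuspidal_kernel_flag[OF cusp b(1-3)])
      fix c assume c: "c \<in> S' K"
      then have c_mat: "c \<in> carrier_mat n n" "mat_kernel c = K" using S_mat by (auto simp: S'_def)
      show "c * u = c" if "u \<in> ?U" for u
        using mult_unipotent_radical[OF c_mat(1) b(1) _ that] b(4) c_mat(2) by simp
      show "h * c \<in> S' K" if h: "h \<in> H" for h
      proof -
        note h' = H_GL[OF h]
        have "mat_kernel (h * c) = mat_kernel c"
        proof
          show "mat_kernel c \<subseteq> mat_kernel (h * c)"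
            by (rule mat_kernel_mult_subset[OF c_mat(1) GL_carrier_mat[OF h']])
          have "mat_kernel (h * c) \<subseteq> mat_kernel (ginv h * (h * c))"
            by (rule mat_kernel_mult_subset[of _ n n _ n])
               (use c_mat GL_carrier_mat[OF h'] GL_carrier_mat[OF inv_closed[OF h']] in auto)
          then show "mat_kernel (h * c) \<subseteq> mat_kernel c"
            by (simp add: ginv_cancel[OF h' c_mat(1)])
        qed
        then show ?thesis using HS[OF h] c by (simp add: S'_def)
      qed
    qed
  qed
  finally show ?thesis .
qed

text \<open>After g is replaced by its inverse, the H-invariance of \<xi> pulls \<xi> (\<pi> x v)
  out of the sum over each coset. The set \<open>D - H\<close> consists of singular matrices and is
  stable under H, so adjoining it adds zero.\<close>

lemma sum_GL_eq_coset_sum: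
  assumes cusp: "cuspidal n scale \<pi>" and n: "n \<ge> 2"
    and D: "D \<subseteq> carrier_mat n n" and H_D: "H = D \<inter> carrier (GL n)"
    and mult_D: "\<And>a b. a \<in> D \<Longrightarrow> b \<in> D \<Longrightarrow> a * b \<in> D"
  shows "(\<Sum>g\<in>carrier (GL n). \<chi> (mat_tr g) * \<xi> (\<pi> (ginv g) v)) =
    coset_sum (GL n) H (twisted \<chi> D v)"
proof -
  have fin: "finite D" using finite_subset[OF D finite_carrier_mat] .
  have "(\<Sum>g\<in>carrier (GL n). \<chi> (mat_tr g) * \<xi> (\<pi> (ginv g) v)) =
      (\<Sum>x\<in>carrier (GL n). \<chi> (mat_tr (ginv x)) * \<xi> (\<pi> x v))"
    by (rule sum.reindex_bij_witness[where i = "\<lambda>x. ginv x" and j = "\<lambda>x. ginv x"]) auto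
  also have "\<dots> = coset_sum (GL n) H
      (\<lambda>x. \<Sum>h\<in>H. \<chi> (mat_tr (ginv (h \<otimes>\<^bsub>GL n\<^esub> x))) * \<xi> (\<pi> (h \<otimes>\<^bsub>GL n\<^esub> x) v))"
    by (rule sum_eq_coset_sum[OF H_subgroup finite_GL])
  also have "\<dots> = coset_sum (GL n) H (twisted \<chi> H v)"
  proof (rule coset_sum_cong[OF H_subgroup])
    fix x :: "'k mat" assume x: "x \<in> carrier (GL n)"
    have "(\<Sum>h\<in>H. \<chi> (mat_tr (ginv (h * x))) * \<xi> (\<pi> (h * x) v)) =
        (\<Sum>h\<in>H. \<chi> (mat_tr (ginv x * ginv h)) * \<xi> (\<pi> x v))"
      using mult[OF H_GL x, of _ v] by (intro sum.cong) (simp_all add: ginv_mult[OF H_GL x] invariant)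
    also have "\<dots> = twisted \<chi> H v x"
      unfolding twisted_def sum_distrib_right
      by (rule sum.reindex_bij_witness[where i = "\<lambda>x. ginv x" and j = "\<lambda>x. ginv x"])
         (auto simp: H_ginv H_GL)
    finally show "(\<Sum>h\<in>H. \<chi> (mat_tr (ginv (h \<otimes>\<^bsub>GL n\<^esub> x))) * \<xi> (\<pi> (h \<otimes>\<^bsub>GL n\<^esub> x) v)) =
        twisted \<chi> H v x" by simp
  qed
  also have "\<dots> = coset_sum (GL n) H (twisted \<chi> H v) + coset_sum (GL n) H (twisted \<chi> (D - H) v)"
  proof -
    have "coset_sum (GL n) H (twisted \<chi> (D - H) v) = 0"
    proof (rule coset_sum_singular_eq_zero[OF cusp n])
      show "D - H \<subseteq> {a \<in> carrier_mat n n. det a = 0}"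
        using D by (auto simp: H_D carrier_GL)
      fix h a assume h: "h \<in> H" and a: "a \<in> D - H"
      have "h * a \<in> D" using h a mult_D by (auto simp: H_D)
      moreover have "h * a \<notin> H"
      proof
        assume "h * a \<in> H"
        then have "ginv h * (h * a) \<in> H"
          using subgroup.m_closed[OF H_subgroup H_ginv[OF h]] by simp
        then show False using a D ginv_cancel[OF H_GL[OF h], of a] by auto
      qed
      ultimately show "h * a \<in> D - H" by simp
    qed
    then show ?thesis by simp
  qed
  also have "\<dots> = coset_sum (GL n) H (twisted \<chi> D v)"
  proof -
    have "twisted \<chi> D v = (\<lambda>x. twisted \<chi> H v x + twisted \<chi> (D - H) v x)"
      unfolding twisted_def
      by (subst sum.subset_diff[of H D]) (use fin in \<open>auto simp: H_D algebra_simps\<close>)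
    then show ?thesis by (simp only: coset_sum_add)
  qed
  finally show ?thesis .
qed

end

section \<open>Exponents of finite groups\<close>

text \<open>Sylow's theorem supplies a subgroup of order q; a nontrivial element of it has order
  dividing both primes q and p.\<close>

lemma (in group) prime_dvd_order_eq:
  assumes fin: "finite (carrier G)" and p: "prime p"
    and pow: "\<And>x. x \<in> carrier G \<Longrightarrow> x [^] p = \<one>"
    and q: "prime q" "q dvd Coset.order G"
  shows "q = (p :: nat)"
proof -
  obtain m where "Coset.order G = q ^ 1 * m" using q by auto
  then obtain K where K: "subgroup K G" "card K = q ^ 1"
    using sylow_thm[OF q(1) is_group _ fin] by blast
  interpret K: group "G\<lparr>carrier := K\<rparr>" by (rule subgroup.subgroup_is_group[OF K(1) is_group])
  have "K \<noteq> {\<one>}" using K(2) prime_gt_1_nat[OF q(1)] by auto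
  then obtain x where x: "x \<in> K" "x \<noteq> \<one>" using subgroup.one_closed[OF K(1)] by blast
  have x': "x \<in> carrier G" using subgroup.mem_carrier[OF K(1) x(1)] .
  have "x [^] q = \<one>"
    using K.pow_order_eq_1[of x] x(1) K(2) by (simp add: Coset.order_def flip: nat_pow_consistent)
  then have "ord x dvd q" using pow_eq_id[OF x'] by blast
  moreover have "ord x dvd p" using pow[OF x'] pow_eq_id[OF x'] by blast
  moreover have "ord x \<noteq> 1" using x x' ord_eq_1 by auto
  ultimately show ?thesis using p q(1) by (metis prime_nat_iff)
qed

text \<open>The additive group of matrices is killed by the characteristic of its field of entries,
  so no other prime divides its order. This makes the normalizing factor of the gamma factor
  invertible.\<close>

lemma of_nat_card_carrier_mat_neq_0:
  assumes "CHAR('r::field) \<noteq> CHAR('k::{field,finite})"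
  shows "(of_nat (card (carrier_mat n n :: 'k mat set)) :: 'r) \<noteq> 0"
proof
  let ?R = "ring_mat TYPE('k) n ()"
  assume "(of_nat (card (carrier_mat n n :: 'k mat set)) :: 'r) = 0"
  then have dvd: "CHAR('r) dvd card (carrier_mat n n :: 'k mat set)"
    by (simp add: of_nat_eq_0_iff_char_dvd)
  moreover have "card (carrier_mat n n :: 'k mat set) \<noteq> 0"
    using finite_carrier_mat[where ?'k = 'k, of n n] zero_carrier_mat[of n n, where ?'a = 'k] by auto
  ultimately have "CHAR('r) > 0" by (intro Nat.gr0I) auto
  then have q: "prime CHAR('r)" by (rule prime_CHAR_semidom)
  have p: "prime CHAR('k)" by (rule prime_CHAR_semidom[OF finite_imp_CHAR_pos[OF finite_UNIV]])
  interpret R: ring ?R by (rule ring_mat)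
  have pow: "(x [^]\<^bsub>add_monoid ?R\<^esub> m) = mat n n (\<lambda>(i, j). of_nat m * x $$ (i, j))"
    if x: "x \<in> carrier_mat n n" for x and m :: nat
  proof (induction m)
    case 0
    show ?case by (auto simp: ring_mat_simps zero_mat_def)
  next
    case (Suc m)
    then show ?case using x by (intro eq_matI) (auto simp: ring_mat_simps algebra_simps)
  qed
  have "CHAR('r) = CHAR('k)"
  proof (rule group.prime_dvd_order_eq[OF R.a_group _ p _ q])
    show "finite (carrier (add_monoid ?R))" by (simp add: ring_mat_simps finite_carrier_mat)
    show "CHAR('r) dvd Coset.order (add_monoid ?R)" using dvd by (simp add: Coset.order_def ring_mat_simps)
    fix x assume "x \<in> carrier (add_monoid ?R)"
    then have x: "x \<in> carrier_mat n n" by (simp add: ring_mat_simps)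
    show "x [^]\<^bsub>add_monoid ?R\<^esub> CHAR('k) = \<one>\<^bsub>add_monoid ?R\<^esub>"
      unfolding pow[OF x] by (auto simp: ring_mat_simps zero_mat_def)
  qed
  with assms show False by simp
qed

section \<open>Additive characters\<close>

lemma additive_character_zero: "additive_character \<psi> \<Longrightarrow> \<psi> 0 = 1"
  unfolding additive_character_def by (metis add.right_neutral mult_cancel_left1)

text \<open>Translation by c leaves the sum unchanged but multiplies it by \<psi> (f c), which is
  not 1.\<close>

lemma sum_additive_character_eq_zero:
  fixes f :: "'a::{ab_group_add,finite} mat \<Rightarrow> 'b::ab_group_add" and \<psi> :: "'b \<Rightarrow> 'r::field"
  assumes \<psi>: "additive_character \<psi>"
    and f: "\<And>a b. a \<in> carrier_mat n n \<Longrightarrow> b \<in> carrier_mat n n \<Longrightarrow> f (a + b) = f a + f b"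
    and c: "c \<in> carrier_mat n n" "\<psi> (f c) \<noteq> 1"
  shows "(\<Sum>a\<in>carrier_mat n n. \<psi> (f a)) = 0"
proof -
  let ?M = "carrier_mat n n :: 'a mat set"
  have "(\<Sum>a\<in>?M. \<psi> (f a)) = (\<Sum>a\<in>?M. \<psi> (f (a + c)))"
    by (rule sum.reindex_bij_witness[where i = "\<lambda>a. a + c" and j = "\<lambda>a. a - c"])
       (use c in \<open>auto simp: minus_add_minus_mat intro!: arg_cong[of _ _ "\<lambda>a. \<psi> (f a)"] eq_matI\<close>)
  also have "\<dots> = \<psi> (f c) * (\<Sum>a\<in>?M. \<psi> (f a))"
    using \<psi> c by (simp add: f sum_distrib_left additive_character_def mult.commute)
  finally have "(1 - \<psi> (f c)) * (\<Sum>a\<in>?M. \<psi> (f a)) = 0" by (simp add: algebra_simps)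
  then show ?thesis using c by simp
qed

section \<open>The trace of a quadratic extension\<close>

locale quadratic_extension = field_hom \<iota>
  for \<iota> :: "'k0::{field,finite} \<Rightarrow> 'k::{field,finite}" +
  assumes dim_2: "vector_space.dim (ext_scale \<iota>) UNIV = 2"
    and odd_char: "odd CHAR('k)"
begin

sublocale ext: vector_space "ext_scale \<iota>"
  by unfold_locales (simp_all add: ext_scale_def hom_add hom_mult algebra_simps)

lemma CHAR_eq: "CHAR('k0) = CHAR('k)"
proof (rule CHAR_eqI[symmetric])
  show "of_nat CHAR('k0) = (0 :: 'k)"
    using hom_of_nat[of "CHAR('k0)"] by (simp del: hom_of_nat)
  fix m :: nat assume "of_nat m = (0 :: 'k)"
  then have "of_nat m = (0 :: 'k0)" by (metis hom_of_nat hom_0_iff)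
  then show "CHAR('k0) dvd m" by (simp only: of_nat_eq_0_iff_char_dvd)
qed

text \<open>This exposes the basis selected by \<open>SOME\<close> inside
  \<open>linear_trace\<close>; the properties of the trace below are computed in that one
  basis.\<close>

lemma exists_trace_basis:
  obtains B where "ext.independent B" "ext.span B = UNIV" "card B = 2"
    "\<And>x. field_trace \<iota> x = (\<Sum>b\<in>B. ext.representation B (x * b) b)"
proof -
  define B where "B = (SOME B. ext.independent B \<and> ext.span B = UNIV)"
  have "\<exists>B. ext.independent B \<and> ext.span B = UNIV"
    using ext.independent_extend_basis[OF ext.independent_empty]
      ext.span_extend_basis[OF ext.independent_empty] by blast
  then have B: "ext.independent B \<and> ext.span B = UNIV"
    unfolding B_def by (rule someI_ex)
  have "card B = 2"
    using ext.dim_unique[of B UNIV 2] ext.basis_card_eq_dim[of B UNIV] B dim_2 by auto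
  moreover have "field_trace \<iota> x = (\<Sum>b\<in>B. ext.representation B (x * b) b)" for x
    by (simp add: field_trace_def linear_trace_def B_def Let_def)
  ultimately show ?thesis using that B by blast
qed

lemma field_trace_add: "field_trace \<iota> (x + y) = field_trace \<iota> x + field_trace \<iota> y"
proof -
  obtain B where B: "ext.independent B" "ext.span B = UNIV"
    "\<And>x. field_trace \<iota> x = (\<Sum>b\<in>B. ext.representation B (x * b) b)"
    using exists_trace_basis by metis
  then show ?thesis by (simp add: distrib_right ext.representation_add sum.distrib)
qed

lemma field_trace_scale: "field_trace \<iota> (\<iota> c * x) = c * field_trace \<iota> x"
proof -
  obtain B where B: "ext.independent B" "ext.span B = UNIV"
    "\<And>x. field_trace \<iota> x = (\<Sum>b\<in>B. ext.representation B (x * b) b)"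
    using exists_trace_basis by metis
  have "ext.representation B (\<iota> c * x * b) b = c * ext.representation B (x * b) b" for b
    using ext.representation_scale[OF B(1), of "x * b" c] B(2) by (simp add: ext_scale_def mult.assoc)
  then show ?thesis by (simp add: B(3) sum_distrib_left)
qed

lemma field_trace_zero [simp]: "field_trace \<iota> 0 = 0"
  using field_trace_scale[of 0 0] by simp

lemma field_trace_sum: "field_trace \<iota> (\<Sum>i\<in>I. f i) = (\<Sum>i\<in>I. field_trace \<iota> (f i))"
  by (induction I rule: infinite_finite_induct) (simp_all add: field_trace_add)

text \<open>The trace of 1 is the degree 2, which is nonzero in odd characteristic.\<close>

lemma field_trace_one: "field_trace \<iota> 1 \<noteq> 0"
proof -
  obtain B where B: "ext.independent B" "ext.span B = UNIV" "card B = 2"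
    "\<And>x. field_trace \<iota> x = (\<Sum>b\<in>B. ext.representation B (x * b) b)"
    using exists_trace_basis by metis
  have "field_trace \<iota> 1 = (\<Sum>b\<in>B. 1)"
    unfolding B(4) by (rule sum.cong) (simp_all add: ext.representation_basis[OF B(1)])
  also have "\<dots> = of_nat 2" using B(3) by simp
  finally have tr: "field_trace \<iota> 1 = of_nat 2" .
  have "\<not> CHAR('k0) dvd 2"
  proof
    assume "CHAR('k0) dvd 2"
    moreover have "prime CHAR('k0)" by (rule prime_CHAR_semidom[OF finite_imp_CHAR_pos[OF finite_UNIV]])
    ultimately have "CHAR('k0) = 2" by (simp add: primes_dvd_imp_eq)
    then show False using odd_char CHAR_eq by simp
  qed
  then show ?thesis unfolding tr of_nat_eq_0_iff_char_dvd .
qed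

section \<open>Elements of trace zero\<close>

context
  fixes \<delta> :: 'k
  assumes \<delta>: "\<delta> \<noteq> 0" "field_trace \<iota> \<delta> = 0"
begin

text \<open>The Cayley--Hamilton identity for the trace-free matrix of multiplication by \<open>\<delta>\<close>.\<close>

lemma square_in_base_field: obtains d where "\<delta> * \<delta> = \<iota> d"
proof -
  obtain B where B: "ext.independent B" "ext.span B = UNIV" "card B = 2"
    "\<And>x. field_trace \<iota> x = (\<Sum>b\<in>B. ext.representation B (x * b) b)"
    using exists_trace_basis by metis
  obtain e f where ef: "B = {e, f}" "e \<noteq> f" using B(3) by (auto simp: card_2_iff)
  let ?r = "\<lambda>x b. ext.representation B (\<delta> * x) b"
  have expand: "\<delta> * x = \<iota> (?r x e) * e + \<iota> (?r x f) * f" for x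
    using ext.sum_representation_eq[OF B(1), of "\<delta> * x" B] B(2) ef
    by (simp add: ext_scale_def)
  \<comment> \<open>Vanishing trace makes the two diagonal entries opposite.\<close>
  have "?r f f = - ?r e e"
    using \<delta>(2) ef B(4)[of \<delta>] by (simp add: eq_neg_iff_add_eq_0 add.commute)
  then obtain a b c where abc: "\<delta> * e = \<iota> a * e + \<iota> b * f" "\<delta> * f = \<iota> c * e + \<iota> (- a) * f"
    using expand[of e] expand[of f] by metis
  have "\<delta> * \<delta> * e = \<iota> a * (\<delta> * e) + \<iota> b * (\<delta> * f)"
    using arg_cong[OF abc(1), of "(*) \<delta>"] by (simp add: algebra_simps)
  also have "\<dots> = \<iota> (a * a + b * c) * e"
    unfolding abc by (simp add: algebra_simps hom_distribs)
  finally have "\<delta> * \<delta> * e = \<iota> (a * a + b * c) * e" .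
  moreover have "e \<noteq> 0" using B(1) ef ext.dependent_zero by auto
  ultimately show ?thesis using that by simp
qed

text \<open>The elements 1 and \<delta> form a basis over the small field, because 1 has nonzero
  trace. Applying the trace to x = a + b \<delta> isolates a, which must vanish.\<close>

lemma trace_zero_imp_multiple:
  assumes "field_trace \<iota> x = 0"
  obtains c where "x = \<delta> * \<iota> c"
proof -
  obtain B where B: "ext.independent B" "ext.span B = UNIV" "card B = 2"
    using exists_trace_basis by metis
  have tr_scale: "field_trace \<iota> (\<iota> c) = c * field_trace \<iota> 1" for c
    using field_trace_scale[of c 1] by simp
  have \<delta>_indep: "ext.independent {\<delta>}" using \<delta> by simp
  have one_notin: "1 \<notin> ext.span {\<delta>}"
  proof
    assume "1 \<in> ext.span {\<delta>}"
    then obtain k where "1 = \<iota> k * \<delta>" by (auto simp: ext.span_singleton ext_scale_def)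
    then have "field_trace \<iota> 1 = 0" using field_trace_scale[of k \<delta>] \<delta> by simp
    then show False using field_trace_one by simp
  qed
  have indep: "ext.independent {1, \<delta>}"
    using ext.independent_insertI[OF one_notin \<delta>_indep] .
  have "1 \<noteq> \<delta>" using one_notin ext.span_base[of \<delta> "{\<delta>}"] by auto
  have "x \<in> ext.span {1, \<delta>}"
  proof (rule ccontr)
    assume x: "x \<notin> ext.span {1, \<delta>}"
    then have "ext.independent {x, 1, \<delta>}" using ext.independent_insertI[OF _ indep] by blast
    moreover have "finite B" using B(3) by (simp add: card_ge_0_finite)
    ultimately have "card {x, 1, \<delta>} \<le> 2"
      using ext.independent_span_bound[of B "{x, 1, \<delta>}"] B by auto
    moreover have "x \<notin> {1, \<delta>}" using x ext.span_base by blast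
    ultimately show False using \<open>1 \<noteq> \<delta>\<close> by simp
  qed
  then obtain a where "x - \<iota> a \<in> ext.span {\<delta>}"
    by (auto simp: ext.span_breakdown_eq[of x 1] ext_scale_def)
  then obtain b where "x - \<iota> a = \<iota> b * \<delta>" by (auto simp: ext.span_singleton ext_scale_def)
  then have x: "x = \<iota> a + \<iota> b * \<delta>" by (simp add: algebra_simps)
  then have "a * field_trace \<iota> 1 = 0"
    using assms \<delta> by (simp add: field_trace_add field_trace_scale tr_scale)
  then have "a = 0" using field_trace_one by simp
  then show ?thesis using that[of b] x by (simp add: mult.commute)
qed

end

section \<open>Character sums over the matrices of the small field\<close>

lemma mat_tr_map_mat:
  assumes "g \<in> carrier_mat n n" "a \<in> carrier_mat n n"
  shows "field_trace \<iota> (mat_tr (g * map_mat \<iota> a)) =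
    (\<Sum>i<n. \<Sum>j<n. a $$ (j, i) * field_trace \<iota> (g $$ (i, j)))"
proof -
  have "mat_tr (g * map_mat \<iota> a) = (\<Sum>i<n. \<Sum>j<n. \<iota> (a $$ (j, i)) * g $$ (i, j))"
    using assms by (simp add: mat_tr_mult[of _ n n] mult.commute)
  then show ?thesis by (simp add: field_trace_sum field_trace_scale)
qed

text \<open>The exponent is linear in a with the traces of the entries of g as coefficients. If all
  of them vanish, every entry is \<delta> times an element of the small field and each term is 1;
  otherwise the character is nontrivial and the sum vanishes.\<close>

lemma sum_character_trace_form:
  fixes \<psi> :: "'k0 \<Rightarrow> 'r::field"
  assumes \<psi>: "additive_character \<psi>" "\<exists>x. \<psi> x \<noteq> 1" and g: "g \<in> carrier_mat n n"
    and \<delta>: "\<delta> \<noteq> 0" "field_trace \<iota> \<delta> = 0"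
  shows "(\<Sum>a\<in>carrier_mat n n. \<psi> (field_trace \<iota> (mat_tr (g * map_mat \<iota> a)))) =
    (if g \<in> (\<lambda>b. \<delta> \<cdot>\<^sub>m map_mat \<iota> b) ` carrier_mat n n
     then of_nat (card (carrier_mat n n :: 'k0 mat set)) else 0)"
proof (cases "\<forall>i<n. \<forall>j<n. field_trace \<iota> (g $$ (i, j)) = 0")
  case True
  have "\<exists>c. g $$ (i, j) = \<delta> * \<iota> c" if "i < n" "j < n" for i j
    using trace_zero_imp_multiple[OF \<delta>] True that by metis
  then obtain c where c: "g $$ (i, j) = \<delta> * \<iota> (c i j)" if "i < n" "j < n" for i j
    by metis
  have "g = \<delta> \<cdot>\<^sub>m map_mat \<iota> (mat n n (\<lambda>(i, j). c i j))"
    using g by (intro eq_matI) (auto simp: c)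
  then have "g \<in> (\<lambda>b. \<delta> \<cdot>\<^sub>m map_mat \<iota> b) ` carrier_mat n n"
    by (rule image_eqI) simp
  then show ?thesis
    using g True by (simp add: mat_tr_map_mat additive_character_zero[OF \<psi>(1)])
next
  case False
  then obtain i j where ij: "i < n" "j < n" "field_trace \<iota> (g $$ (i, j)) \<noteq> 0" by blast
  obtain x where x: "\<psi> x \<noteq> 1" using \<psi>(2) by blast
  \<comment> \<open>The single nonzero entry sits at the transposed position (j, i), scaled so that
    the linear form takes the value x, on which \<psi> is not 1.\<close>
  define e where "e = mat n n (\<lambda>(r, s). if r = j \<and> s = i then x / field_trace \<iota> (g $$ (i, j)) else 0)"
  have e: "e \<in> carrier_mat n n" by (simp add: e_def)
  have "field_trace \<iota> (mat_tr (g * map_mat \<iota> e)) =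
      (\<Sum>r<n. \<Sum>s<n. if r = i then if s = j then x else 0 else 0)"
    unfolding mat_tr_map_mat[OF g e]
    by (intro sum.cong refl) (use ij in \<open>auto simp: e_def\<close>)
  also have "\<dots> = (\<Sum>r<n. if r = i then x else 0)"
    by (rule sum.cong) (use ij in auto)
  also have "\<dots> = x" using ij by simp
  finally have "\<psi> (field_trace \<iota> (mat_tr (g * map_mat \<iota> e))) \<noteq> 1" using x by simp
  then have "(\<Sum>a\<in>carrier_mat n n. \<psi> (field_trace \<iota> (mat_tr (g * map_mat \<iota> a)))) = 0"
    by (intro sum_additive_character_eq_zero[OF \<psi>(1) _ e])
       (simp_all add: mat_tr_map_mat[OF g] distrib_right sum.distrib)
  moreover have "g \<notin> (\<lambda>b. \<delta> \<cdot>\<^sub>m map_mat \<iota> b) ` carrier_mat n n"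
  proof
    assume "g \<in> (\<lambda>b. \<delta> \<cdot>\<^sub>m map_mat \<iota> b) ` carrier_mat n n"
    then obtain b where "b \<in> carrier_mat n n" "g = \<delta> \<cdot>\<^sub>m map_mat \<iota> b" by blast
    then have "g $$ (i, j) = \<iota> (b $$ (i, j)) * \<delta>" using ij by simp
    then show False using ij \<delta> by (simp add: field_trace_scale)
  qed
  ultimately show ?thesis by simp
qed

end

section \<open>The Gauss sum on an invariant functional\<close>

context quadratic_extension
begin

lemma map_mat_GL_iff:
  assumes "a \<in> carrier_mat n n"
  shows "map_mat \<iota> a \<in> carrier (GL n) \<longleftrightarrow> a \<in> carrier (GL n)"
  using assms by (simp add: carrier_GL)

lemma map_mat_GL:
  "map_mat \<iota> ` carrier (GL n) = map_mat \<iota> ` carrier_mat n n \<inter> carrier (GL n)"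
  using map_mat_GL_iff by (auto simp: carrier_GL)

lemma subgroup_map_mat_GL: "subgroup (map_mat \<iota> ` carrier (GL n)) (GL n)"
proof -
  interpret G: group "GL n :: 'k mat monoid" by (rule group_GL)
  interpret G0: group "GL n :: 'k0 mat monoid" by (rule group_GL)
  have mult: "map_mat \<iota> a * map_mat \<iota> b = map_mat \<iota> (a * b)"
    if "a \<in> carrier (GL n)" "b \<in> carrier (GL n)" for a b
    using that by (subst mat_hom_mult[of _ n n _ n]) (simp_all add: carrier_GL)
  show ?thesis
  proof (rule G.subgroupI)
    show "map_mat \<iota> ` carrier (GL n) \<subseteq> carrier (GL n)" unfolding map_mat_GL by blast
    show "map_mat \<iota> ` carrier (GL n) \<noteq> {}" using G0.one_closed by blast
  next
    fix x assume "x \<in> map_mat \<iota> ` carrier (GL n)"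
    then obtain a where a: "a \<in> carrier (GL n)" "x = map_mat \<iota> a" by blast
    have "inv\<^bsub>GL n\<^esub> x = map_mat \<iota> (inv\<^bsub>GL n\<^esub> a)"
    proof (rule G.inv_equality)
      show "map_mat \<iota> (inv\<^bsub>GL n\<^esub> a) \<otimes>\<^bsub>GL n\<^esub> x = \<one>\<^bsub>GL n\<^esub>"
        using a G0.l_inv[OF a(1)] by (simp add: mult[OF G0.inv_closed] mat_hom_one)
      show "x \<in> carrier (GL n)" "map_mat \<iota> (inv\<^bsub>GL n\<^esub> a) \<in> carrier (GL n)"
        using a G0.inv_closed[OF a(1)] map_mat_GL by blast+
    qed
    then show "inv\<^bsub>GL n\<^esub> x \<in> map_mat \<iota> ` carrier (GL n)" using G0.inv_closed[OF a(1)] by blast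
  next
    fix x y assume "x \<in> map_mat \<iota> ` carrier (GL n)" "y \<in> map_mat \<iota> ` carrier (GL n)"
    then obtain a b where "a \<in> carrier (GL n)" "x = map_mat \<iota> a" "b \<in> carrier (GL n)" "y = map_mat \<iota> b"
      by blast
    then show "x \<otimes>\<^bsub>GL n\<^esub> y \<in> map_mat \<iota> ` carrier (GL n)"
      using G0.m_closed[of a b] mult by auto
  qed
qed

text \<open>A coset H x contributes only if the inverse of x is \<delta> times a matrix over the
  small field. That matrix is then invertible, so H x is the coset of the scalar matrix of the
  inverse of \<delta>.\<close>

lemma sum_twisted_eq:
  fixes \<psi> :: "'k0 \<Rightarrow> 'r::field" and \<xi> :: "'v::ab_group_add \<Rightarrow> 'r" and scale :: "'r \<Rightarrow> 'v \<Rightarrow> 'v"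
  assumes "group_representation (GL n) scale \<pi>" and cusp: "cuspidal n scale \<pi>" and n: "n \<ge> 2"
    and \<xi>: "Vector_Spaces.linear scale (*) \<xi>"
    and inv: "\<And>h v. h \<in> map_mat \<iota> ` carrier (GL n) \<Longrightarrow> \<xi> (\<pi> h v) = \<xi> v"
    and \<psi>: "additive_character \<psi>" "\<exists>x. \<psi> x \<noteq> 1"
    and \<delta>: "\<delta> \<noteq> 0" "field_trace \<iota> \<delta> = 0"
  shows "(\<Sum>g\<in>carrier (GL n). \<psi> (field_trace \<iota> (mat_tr g)) * \<xi> (\<pi> (inv\<^bsub>GL n\<^esub> g) v)) =
    of_nat (card (carrier_mat n n :: 'k0 mat set)) * \<xi> (\<pi> (inverse \<delta> \<cdot>\<^sub>m 1\<^sub>m n) v)"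
proof -
  define H where "H = map_mat \<iota> ` carrier (GL n)"
  define D where "D = map_mat \<iota> ` carrier_mat n n"
  interpret group_representation "GL n" scale \<pi> by fact
  interpret gl_representation n scale \<pi> H \<xi>
  proof (intro gl_representation.intro gl_representation_axioms.intro)
    show "group_representation (GL n) scale \<pi>" by fact
    show "subgroup H (GL n)" unfolding H_def by (rule subgroup_map_mat_GL)
    show "Vector_Spaces.linear scale (*) \<xi>" by (rule \<xi>)
    show "\<xi> (\<pi> h v) = \<xi> v" if "h \<in> H" for h v using that unfolding H_def by (rule inv)
  qed
  let ?\<psi> = "\<lambda>x. \<psi> (field_trace \<iota> x)" and ?y = "inverse \<delta> \<cdot>\<^sub>m 1\<^sub>m n"
  have H_D: "H = D \<inter> carrier (GL n)" unfolding H_def D_def by (rule map_mat_GL)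
  have y: "?y \<in> carrier (GL n)" using \<delta> by (intro scalar_mat_GL) simp
  have inv_y: "ginv ?y = \<delta> \<cdot>\<^sub>m 1\<^sub>m n" using \<delta> by (simp add: inv_scalar_mat_GL)
  \<comment> \<open>Injectivity turns the sum over \<open>D\<close> into a sum over all matrices of
    the small field, where the character sum is known.\<close>
  have "inj_on (map_mat \<iota>) (carrier_mat n n)" using mat_hom_inj by (auto intro: inj_onI)
  then have twisted_eq: "twisted ?\<psi> D v x =
      (if ginv x \<in> (\<lambda>b. \<delta> \<cdot>\<^sub>m map_mat \<iota> b) ` carrier_mat n n
       then of_nat (card (carrier_mat n n :: 'k0 mat set)) else 0) * \<xi> (\<pi> x v)"
    if "x \<in> carrier (GL n)" for x
    unfolding twisted_def D_def
    using sum_character_trace_form[OF \<psi> GL_carrier_mat[OF inv_closed[OF that]] \<delta>]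
    by (simp add: sum.reindex)
  have "(\<Sum>g\<in>carrier (GL n). ?\<psi> (mat_tr g) * \<xi> (\<pi> (ginv g) v)) =
      coset_sum (GL n) H (twisted ?\<psi> D v)"
  proof (rule sum_GL_eq_coset_sum[OF cusp n _ H_D])
    show "D \<subseteq> carrier_mat n n" by (auto simp: D_def)
    fix a b assume "a \<in> D" "b \<in> D"
    then show "a * b \<in> D"
      by (auto simp: D_def mat_hom_mult[symmetric, of _ n n _ n] intro!: imageI)
  qed
  also have "\<dots> = twisted ?\<psi> D v ?y"
  proof (rule coset_sum_single[OF H_subgroup _ y finite_GL])
    show "twisted ?\<psi> D v (h \<otimes>\<^bsub>GL n\<^esub> x) = twisted ?\<psi> D v x"
      if "h \<in> H" "x \<in> carrier (GL n)" for h x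
    proof -
      have "D \<subseteq> carrier_mat n n" by (auto simp: D_def)
      moreover have "h * a \<in> D" if "h \<in> H" "a \<in> D" for h a
        using that unfolding H_D
        by (auto simp: D_def mat_hom_mult[symmetric, of _ n n _ n] intro!: imageI)
      ultimately show ?thesis using twisted_invariant[of D h x] that by simp
    qed
    fix x assume x: "x \<in> carrier (GL n)" "x \<notin> H #>\<^bsub>GL n\<^esub> ?y"
    have "ginv x \<notin> (\<lambda>b. \<delta> \<cdot>\<^sub>m map_mat \<iota> b) ` carrier_mat n n"
    proof
      assume "ginv x \<in> (\<lambda>b. \<delta> \<cdot>\<^sub>m map_mat \<iota> b) ` carrier_mat n n"
      then obtain b where b: "b \<in> carrier_mat n n" "ginv x = \<delta> \<cdot>\<^sub>m map_mat \<iota> b" by blast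
      have bH: "map_mat \<iota> b \<in> H"
        using b \<delta> inv_closed[OF x(1)] by (auto simp: H_D D_def carrier_GL det_smult)
      have "ginv x = ginv ?y * map_mat \<iota> b"
        using b by (simp add: inv_y scalar_mat_mult)
      then have "ginv (ginv x) = ginv (map_mat \<iota> b) * ginv (ginv ?y)"
        using ginv_mult[OF inv_closed[OF y] H_GL[OF bH]] by simp
      then have "x = ginv (map_mat \<iota> b) * ?y" using x y by simp
      then have "x \<in> H #>\<^bsub>GL n\<^esub> ?y" using H_ginv[OF bH] by (auto simp: r_coset_def)
      with x show False by blast
    qed
    then show "twisted ?\<psi> D v x = 0" by (simp add: twisted_eq[OF x(1)])
  qed
  also have "\<dots> = of_nat (card (carrier_mat n n :: 'k0 mat set)) * \<xi> (\<pi> ?y v)"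
  proof -
    have "ginv ?y \<in> (\<lambda>b. \<delta> \<cdot>\<^sub>m map_mat \<iota> b) ` carrier_mat n n"
      unfolding inv_y by (rule image_eqI[where x = "1\<^sub>m n"]) (simp_all only: mat_hom_one one_carrier_mat)
    then show ?thesis unfolding twisted_eq[OF y] by (simp only: if_True)
  qed
  finally show ?thesis .
qed

end

section \<open>Scalar operators\<close>

text \<open>Conjugation preserves the trace, so the sum commutes with the group. Its value at v is a
  combination of the vectors \<pi> g v, as Schur's lemma requires.\<close>

lemma sum_class_function_scalar:
  fixes \<pi> :: "'k::{field,finite} mat \<Rightarrow> 'v::ab_group_add \<Rightarrow> 'v" and scale :: "'r::field \<Rightarrow> 'v \<Rightarrow> 'v"
  assumes rep: "group_representation (GL n) scale \<pi>" and irr: "absolutely_irreducible (GL n) scale \<pi>"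
  obtains c where
    "\<And>v. (\<Sum>g\<in>carrier (GL n). scale (\<psi> (mat_tr g)) (\<pi> (inv\<^bsub>GL n\<^esub> g) v)) = scale c v"
proof -
  interpret group_representation "GL n" scale \<pi> by fact
  let ?inv = "\<lambda>g. inv\<^bsub>GL n\<^esub> g"
  define T where "T v = (\<Sum>g\<in>carrier (GL n). scale (\<psi> (mat_tr g)) (\<pi> (?inv g) v))" for v
  have linear_inv: "Vector_Spaces.linear scale scale (\<pi> (?inv g))" if "g \<in> carrier (GL n)" for g
    using that by (intro linear inv_closed)
  have "Vector_Spaces.linear scale scale T"
    unfolding Vector_Spaces.linear_iff
  proof (intro conjI allI)
    show "T (v + w) = T v + T w" for v w
      unfolding T_def sum.distrib[symmetric]
    proof (rule sum.cong[OF refl])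
      fix g :: "'k mat" assume "g \<in> carrier (GL n)"
      then interpret g: Vector_Spaces.linear scale scale "\<pi> (?inv g)" by (rule linear_inv)
      show "scale (\<psi> (mat_tr g)) (\<pi> (?inv g) (v + w)) =
          scale (\<psi> (mat_tr g)) (\<pi> (?inv g) v) + scale (\<psi> (mat_tr g)) (\<pi> (?inv g) w)"
        by (simp add: g.add scale_right_distrib)
    qed
    show "T (scale c v) = scale c (T v)" for c v
      unfolding T_def scale_sum_right
    proof (rule sum.cong[OF refl])
      fix g :: "'k mat" assume "g \<in> carrier (GL n)"
      then interpret g: Vector_Spaces.linear scale scale "\<pi> (?inv g)" by (rule linear_inv)
      show "scale (\<psi> (mat_tr g)) (\<pi> (?inv g) (scale c v)) =
          scale c (scale (\<psi> (mat_tr g)) (\<pi> (?inv g) v))"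
        by (simp add: g.scale mult.commute)
    qed
  qed (rule vector_space_axioms)+
  moreover have "T (\<pi> h v) = \<pi> h (T v)" if h: "h \<in> carrier (GL n)" for h v
  proof -
    interpret h: Vector_Spaces.linear scale scale "\<pi> h" by (rule linear[OF h])
    have tr: "mat_tr (x * g * y) = mat_tr g" if "g \<in> carrier (GL n)" "x \<in> carrier (GL n)"
      "y \<in> carrier (GL n)" "y * x = 1\<^sub>m n" for g x y :: "'k mat"
    proof -
      have "mat_tr ((x * g) * y) = mat_tr (y * (x * g))"
        using that by (intro mat_tr_comm[of _ n n]) (auto simp: carrier_GL)
      also have "y * (x * g) = (y * x) * g"
        using that by (intro assoc_mult_mat[symmetric, of _ n n _ n _ n]) (auto simp: carrier_GL)
      finally show ?thesis using that left_mult_one_mat[of g n n] by (simp add: carrier_GL)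
    qed
    have "T (\<pi> h v) = (\<Sum>g\<in>carrier (GL n). \<pi> h (scale (\<psi> (mat_tr g)) (\<pi> (?inv g) v)))"
      unfolding T_def
    \<comment> \<open>The change of variable conjugates by h: it keeps the weight and carries \<pi>
      h across the operator.\<close>
    proof (rule sum.reindex_bij_witness[where
          i = "\<lambda>g. h \<otimes>\<^bsub>GL n\<^esub> g \<otimes>\<^bsub>GL n\<^esub> ?inv h" and j = "\<lambda>g. ?inv h \<otimes>\<^bsub>GL n\<^esub> g \<otimes>\<^bsub>GL n\<^esub> h"])
      fix g :: "'k mat" assume g: "g \<in> carrier (GL n)"
      show "h \<otimes>\<^bsub>GL n\<^esub> (?inv h \<otimes>\<^bsub>GL n\<^esub> g \<otimes>\<^bsub>GL n\<^esub> h) \<otimes>\<^bsub>GL n\<^esub> ?inv h = g"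
        "?inv h \<otimes>\<^bsub>GL n\<^esub> (h \<otimes>\<^bsub>GL n\<^esub> g \<otimes>\<^bsub>GL n\<^esub> ?inv h) \<otimes>\<^bsub>GL n\<^esub> h = g"
        using g h by (simp_all add: m_assoc[symmetric] del: mult_GL one_GL)
           (simp_all add: m_assoc del: mult_GL one_GL)
      show "?inv h \<otimes>\<^bsub>GL n\<^esub> g \<otimes>\<^bsub>GL n\<^esub> h \<in> carrier (GL n)" "h \<otimes>\<^bsub>GL n\<^esub> g \<otimes>\<^bsub>GL n\<^esub> ?inv h \<in> carrier (GL n)"
        using g h by (simp_all del: mult_GL one_GL)
      have "mat_tr (?inv h \<otimes>\<^bsub>GL n\<^esub> g \<otimes>\<^bsub>GL n\<^esub> h) = mat_tr g"
        using tr[OF g inv_closed[OF h] h] r_inv[OF h] by simp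
      moreover have "\<pi> h (\<pi> (?inv (?inv h \<otimes>\<^bsub>GL n\<^esub> g \<otimes>\<^bsub>GL n\<^esub> h)) v) = \<pi> (?inv g) (\<pi> h v)"
      proof -
        have "h \<otimes>\<^bsub>GL n\<^esub> ?inv (?inv h \<otimes>\<^bsub>GL n\<^esub> g \<otimes>\<^bsub>GL n\<^esub> h) = ?inv g \<otimes>\<^bsub>GL n\<^esub> h"
          using g h by (simp add: inv_mult_group m_assoc[symmetric] del: mult_GL one_GL)
        then show ?thesis using g h by (simp del: mult_GL flip: mult)
      qed
      ultimately show "\<pi> h (scale (\<psi> (mat_tr (?inv h \<otimes>\<^bsub>GL n\<^esub> g \<otimes>\<^bsub>GL n\<^esub> h)))
          (\<pi> (?inv (?inv h \<otimes>\<^bsub>GL n\<^esub> g \<otimes>\<^bsub>GL n\<^esub> h)) v)) = scale (\<psi> (mat_tr g)) (\<pi> (?inv g) (\<pi> h v))"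
        by (simp add: h.scale)
    qed
    then show ?thesis by (simp add: T_def h.sum)
  qed
  moreover have "T v \<in> span ((\<lambda>g. \<pi> g v) ` carrier (GL n))" for v
    unfolding T_def by (intro span_sum span_scale span_base imageI inv_closed)
  ultimately show ?thesis
    using schur[OF irr finite_GL, of T] that by (auto simp: T_def)
qed

lemma scalar_matrix_scalar:
  fixes \<pi> :: "'k::{field,finite} mat \<Rightarrow> 'v::ab_group_add \<Rightarrow> 'v" and scale :: "'r::field \<Rightarrow> 'v \<Rightarrow> 'v"
  assumes rep: "group_representation (GL n) scale \<pi>" and irr: "absolutely_irreducible (GL n) scale \<pi>"
    and z: "z \<noteq> 0"
  obtains c where "\<And>v. \<pi> (z \<cdot>\<^sub>m 1\<^sub>m n) v = scale c v"
proof -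
  interpret group_representation "GL n" scale \<pi> by fact
  note Z = scalar_mat_GL[OF z, of n]
  have "\<pi> (z \<cdot>\<^sub>m 1\<^sub>m n) (\<pi> g v) = \<pi> g (\<pi> (z \<cdot>\<^sub>m 1\<^sub>m n) v)" if g: "g \<in> carrier (GL n)" for g v
    using mult[OF Z g, of v] mult[OF g Z, of v] g by (simp add: carrier_GL scalar_mat_mult)
  moreover have "\<pi> (z \<cdot>\<^sub>m 1\<^sub>m n) v \<in> span ((\<lambda>g. \<pi> g v) ` carrier (GL n))" for v
    using Z by (intro span_base imageI)
  ultimately show ?thesis
    using schur[OF irr finite_GL linear[OF Z]] that by blast
qed

lemma dual_space_nonzeroE:
  assumes "\<xi> \<in> dual_space scale" "\<exists>v. \<xi> v \<noteq> 0"
  obtains v where "\<xi> v \<noteq> 0" "v \<noteq> 0"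
proof -
  interpret Vector_Spaces.linear scale "(*)" \<xi> using assms(1) by (simp add: dual_space_def)
  from assms(2) obtain v where "\<xi> v \<noteq> 0" by blast
  moreover from this have "v \<noteq> 0" using zero by auto
  ultimately show ?thesis using that by blast
qed

section \<open>Evaluation of the gamma factor\<close>

theorem theorem5p1:
  fixes \<iota> :: "'k0::{field,finite} \<Rightarrow> 'k::{field,finite}"
    and n :: nat
    and scale :: "'r::field \<Rightarrow> 'v::ab_group_add \<Rightarrow> 'v"
    and \<pi> :: "'k mat \<Rightarrow> 'v \<Rightarrow> 'v"
    and \<psi>\<^sub>0 :: "'k0 \<Rightarrow> 'r"
    and sqrtM :: 'r
    and \<delta> :: 'k
  assumes "field_hom \<iota>"
    and "vector_space.dim (ext_scale \<iota>) UNIV = 2"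
    and "odd CHAR('k)"
    and "n \<ge> 2"
    and "CHAR('r) \<noteq> CHAR('k)"
    and "card {\<zeta>::'r. \<zeta> ^ CHAR('k) = 1} = CHAR('k)"
    and "group_representation (GL n) scale \<pi>"
    and "absolutely_irreducible (GL n) scale \<pi>"
    and "cuspidal n scale \<pi>"
    and "distinguished scale \<pi> (map_mat \<iota> ` carrier (GL n))"
    and "additive_character \<psi>\<^sub>0"
    and "\<exists>x. \<psi>\<^sub>0 x \<noteq> 1"
    and "sqrtM ^ 2 = of_nat (card (carrier_mat n n :: 'k mat set))"
    and "sqrtM = of_nat (card (carrier_mat n n :: 'k0 mat set))"
    and "\<delta> \<noteq> 0"
    and "field_trace \<iota> \<delta> = 0"
  shows "gamma_factor n scale \<pi> sqrtM (\<psi>\<^sub>0 \<circ> field_trace \<iota>) = central_character n scale \<pi> \<delta>"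
proof -
  interpret quadratic_extension \<iota>
    using assms(1-3) by (simp add: quadratic_extension_def quadratic_extension_axioms_def)
  interpret group_representation "GL n" scale \<pi> by (rule assms(7))
  let ?\<psi> = "\<lambda>x. \<psi>\<^sub>0 (field_trace \<iota> x)"
  define Z where "Z = \<delta> \<cdot>\<^sub>m 1\<^sub>m n"
  have Z: "Z \<in> carrier (GL n)" using scalar_mat_GL[OF assms(15)] by (simp add: Z_def)
  obtain \<xi> where \<xi>: "\<xi> \<in> dual_space scale" "\<exists>v. \<xi> v \<noteq> 0"
    and \<xi>_inv: "\<And>h v. h \<in> map_mat \<iota> ` carrier (GL n) \<Longrightarrow> \<xi> (\<pi> h v) = \<xi> v"
    using assms(10) by (auto simp: distinguished_def)
  interpret \<xi>: Vector_Spaces.linear scale "(*)" \<xi> using \<xi>(1) by (simp add: dual_space_def)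
  obtain w where w: "\<xi> w \<noteq> 0" "w \<noteq> 0" using dual_space_nonzeroE[OF \<xi>] by blast
  obtain \<omega> where \<omega>: "\<And>v. \<pi> Z v = scale \<omega> v"
    using scalar_matrix_scalar[OF assms(7,8,15)] unfolding Z_def by blast
  obtain c where c: "\<And>v. (\<Sum>g\<in>carrier (GL n). scale (?\<psi> (mat_tr g)) (\<pi> (inv\<^bsub>GL n\<^esub> g) v)) = scale c v"
    using sum_class_function_scalar[OF assms(7,8), of ?\<psi>] by blast
  have functional_c: "(\<Sum>g\<in>carrier (GL n). ?\<psi> (mat_tr g) * \<eta> (\<pi> (inv\<^bsub>GL n\<^esub> g) v)) = c * \<eta> v"
    if "\<eta> \<in> dual_space scale" for \<eta> v
  proof -
    interpret \<eta>: Vector_Spaces.linear scale "(*)" \<eta> using that by (simp add: dual_space_def)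
    show ?thesis using arg_cong[OF c[of v], of \<eta>] by (simp add: \<eta>.sum \<eta>.scale)
  qed
  have s: "sqrtM \<noteq> 0"
    unfolding assms(14) by (rule of_nat_card_carrier_mat_neq_0) (use assms(5) CHAR_eq in simp)

  \<comment> \<open>Evaluating at \<pi> Z w instead of w cancels the inverse of \<delta> produced by
    the Gauss sum, which gives c \<omega> = \<open>sqrtM\<close>.\<close>
  have "c * \<xi> (\<pi> Z w) = (\<Sum>g\<in>carrier (GL n). ?\<psi> (mat_tr g) * \<xi> (\<pi> (inv\<^bsub>GL n\<^esub> g) (\<pi> Z w)))"
    by (rule functional_c[OF \<xi>(1), symmetric])
  also have "\<dots> = sqrtM * \<xi> (\<pi> (inverse \<delta> \<cdot>\<^sub>m 1\<^sub>m n) (\<pi> Z w))"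
    unfolding assms(14)
  proof (rule sum_twisted_eq[OF assms(7,9,4) \<xi>.linear_axioms _ assms(11,12,15,16)])
    show "\<xi> (\<pi> h v) = \<xi> v" if "h \<in> map_mat \<iota> ` carrier (GL n)" for h v
      using that by (rule \<xi>_inv)
  qed
  also have "\<pi> (inverse \<delta> \<cdot>\<^sub>m 1\<^sub>m n) (\<pi> Z w) = w"
    using mult[OF inv_closed[OF Z] Z, of w] l_inv[OF Z] one[of w] assms(15)
    by (simp add: inv_scalar_mat_GL Z_def)
  finally have c_\<omega>: "c * \<omega> = sqrtM" using w by (simp add: \<omega> \<xi>.scale)

  \<comment> \<open>The square of \<open>Z\<close> is a scalar matrix over the small field, so it
    fixes \<xi>. Hence \<omega> is its own inverse and c = \<open>sqrtM\<close> \<omega>.\<close>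
  obtain d where d: "\<delta> * \<delta> = \<iota> d" using square_in_base_field[OF assms(15,16)] by blast
  have "Z * Z = map_mat \<iota> (d \<cdot>\<^sub>m 1\<^sub>m n)"
    unfolding Z_def by (intro eq_matI) (auto simp: d)
  moreover have "d \<noteq> 0" using d assms(15) by auto
  ultimately have "Z * Z \<in> map_mat \<iota> ` carrier (GL n)" using scalar_mat_GL by blast
  then have "\<omega> * (\<omega> * \<xi> w) = \<xi> w"
    using \<xi>_inv[of "Z * Z" w] mult[OF Z Z, of w] by (simp add: \<omega> \<xi>.scale)
  then have "\<omega> * \<omega> = 1" using w by simp
  then have c_eq: "c = sqrtM * \<omega>" using c_\<omega> by (metis mult.assoc mult.right_neutral)

  have "central_character n scale \<pi> \<delta> = \<omega>"
    unfolding central_character_def Z_def[symmetric]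
  proof (rule the_equality)
    fix c assume "\<forall>v. \<pi> Z v = scale c v"
    then have "scale c w = scale \<omega> w" using \<omega> by metis
    then show "c = \<omega>" using w by simp
  qed (use \<omega> in blast)
  moreover have "gamma_factor n scale \<pi> sqrtM (\<psi>\<^sub>0 \<circ> field_trace \<iota>) = \<omega>"
    \<comment> \<open>The factor \<open>inverse sqrtM\<close> cancels because \<open>sqrtM\<close>
      is nonzero in R. Testing against \<xi> at w, where \<xi> w is nonzero, gives the uniqueness
      required by the definite description.\<close>
    unfolding gamma_factor_def contragredient_def comp_def
  proof (rule the_equality)
    show "\<forall>\<eta>\<in>dual_space scale. \<forall>v. inverse sqrtM *
        (\<Sum>g\<in>carrier (GL n). ?\<psi> (mat_tr g) * \<eta> (\<pi> (inv\<^bsub>GL n\<^esub> g) v)) = \<omega> * \<eta> v"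
      using functional_c s by (simp add: c_eq)
    fix c' assume "\<forall>\<eta>\<in>dual_space scale. \<forall>v. inverse sqrtM *
        (\<Sum>g\<in>carrier (GL n). ?\<psi> (mat_tr g) * \<eta> (\<pi> (inv\<^bsub>GL n\<^esub> g) v)) = c' * \<eta> v"
    then have "inverse sqrtM * (c * \<xi> w) = c' * \<xi> w"
      using \<xi>(1) unfolding functional_c[OF \<xi>(1), symmetric] by blast
    then show "c' = \<omega>" using w s by (simp add: c_eq)
  qed
  ultimately show ?thesis by simp
qed

end
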